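(* Let $\mathcal A$ and $\mathfrak A$ be Banach algebras such that $\mathcal A$ is a Banach $\mathfrak A$-bimodule with compatible actions, and let $n\ge0$ be an integer. A bounded linear map $D:\mathcal A\rtimes\mathfrak A\to(\mathcal A\rtimes\mathfrak A)^{(2n+1)}$ is a derivation if and only if there exist derivations $D^1_{\mathcal A}:\mathcal A\to\mathcal A^{(2n+1)}$, $D^1_{\mathfrak A}:\mathfrak A\to\mathcal A^{(2n+1)}$, $D^2_{\mathfrak A}:\mathfrak A\to\mathfrak A^{(2n+1)}$ and a bounded linear map $D^2_{\mathcal A}:\mathcal A\to\mathfrak A^{(2n+1)}$ such that for all $a,b\in\mathcal A$ and $\beta\in\mathfrak A$: (i) $D((a,\beta))=(D^1_{\mathcal A}(a)+D^1_{\mathfrak A}(\beta),\ D^2_{\mathcal A}(a)+D^2_{\mathfrak A}(\beta))$; (ii) $D^1_{\mathcal A}(\beta\cdot a)=D^1_{\mathfrak A}(\beta)\circ a+\beta\blacktriangle D^1_{\mathcal A}(a)$ and $D^1_{\mathcal A}(a\cdot\beta)=a\vartriangle D^1_{\mathfrak A}(\beta)+D^1_{\mathcal A}(a)\bullet\beta$; (iii) $D^2_{\mathcal A}(\beta\cdot a)=D^1_{\mathfrak A}(\beta)\bullet a+\beta\vartriangle D^2_{\mathcal A}(a)$ and $D^2_{\mathcal A}(a\cdot\beta)=a\blacktriangle D^1_{\mathfrak A}(\beta)+D^2_{\mathcal A}(a)\circ\beta$; (iv) $D^2_{\mathcal A}(ab)=D^1_{\mathcal A}(a)\bullet b+a\blacktriangle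 D^1_{\mathcal A}(b)$.
   Context: The actions of $\mathfrak A$ on $\mathcal A$ are compatible if for all $a,b\in\mathcal A$ and $\beta\in\mathfrak A$: $\beta\cdot(ab)=(\beta\cdot a)b$, $(ab)\cdot\beta=a(b\cdot\beta)$, $a(\beta\cdot b)=(a\cdot\beta)b$. The amalgamated duplication $\mathcal A\rtimes\mathfrak A$ is $\mathcal A\times\mathfrak A$ with product $(a,\beta)(b,\gamma)=(ab+a\cdot\gamma+\beta\cdot b,\ \beta\gamma)$ and norm $\|(a,\beta)\|=\|a\|+\|\beta\|$. $\mathcal Y^{(k)}$ is the $k$-th dual of a Banach space $\mathcal Y$ ($\mathcal Y^{(0)}=\mathcal Y$), and $(\mathcal A\rtimes\mathfrak A)^{(k)}$ is identified with $\mathcal A^{(k)}\times\mathfrak A^{(k)}$ via the coordinatewise pairing. If $\mathcal X$ is a Banach $\mathcal C$-bimodule, its dual is one via $\langle x^{(1)}\cdot c,x\rangle=\langle x^{(1)},c\cdot x\rangle$, $\langle c\cdot x^{(1)},x\rangle=\langle x^{(1)},x\cdot c\rangle$; iterating gives the bimodule structure on every $\mathcal X^{(k)}$. For $a\in\mathcal A$, $\beta\in\mathfrak A$ write: $a\vartriangle x$, $x\circ a$ for the left and right actions of $\mathcal A$ on $x\in\mathcal A^{(k)}$; $\beta\vartriangle y$, $y\circ\beta$ for the left and right actions of $\mathfrak A$ on $y\in\mathfrak A^{(k)}$; $\beta\blacktriangle x$, $x\bullet\beta$ for the left and right actions of $\mathfrak A$ on $x\in\mathcal A^{(k)}$ (all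 induced by iterated dualization from the products and from the given bimodule action). Mixed operations: for $y\in\mathfrak A^{(2m)}$ the elements $a\blacktriangle y,\ y\bullet a\in\mathcal A^{(2m)}$ and for $x\in\mathcal A^{(2m+1)}$ the elements $a\blacktriangle x,\ x\bullet a\in\mathfrak A^{(2m+1)}$ are defined recursively by: for $m=0$, $a\blacktriangle y=a\cdot y$ and $y\bullet a=y\cdot a$; $\langle a\blacktriangle x,y\rangle=\langle x,y\bullet a\rangle$ and $\langle x\bullet a,y\rangle=\langle x,a\blacktriangle y\rangle$ for $x\in\mathcal A^{(2m+1)}$, $y\in\mathfrak A^{(2m)}$; $\langle a\blacktriangle y,x\rangle=\langle y,x\bullet a\rangle$ and $\langle y\bullet a,x\rangle=\langle y,a\blacktriangle x\rangle$ for $y\in\mathfrak A^{(2m+2)}$, $x\in\mathcal A^{(2m+1)}$. A derivation from a Banach algebra $\mathcal C$ into a Banach $\mathcal C$-bimodule $\mathcal X$ is a continuous linear map $D$ with $D(c_1c_2)=D(c_1)\cdot c_2+c_1\cdot D(c_2)$. *)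

theory Defs
  imports "HOL-Analysis.Analysis" "HOL-Library.Function_Algebras"
begin

section \<open>Normed spaces on carrier sets\<close>

text \<open>
  The spaces \<open>\<Y>, \<Y>', \<Y>'', \<dots>\<close>, up to a level that is a variable of the statement, must share one
  HOL type, so normed spaces are carrier sets: a space is a linear subspace of an ambient vector
  space \<open>'u\<close> together with a norm on that subspace. The ambient vector space carries no further
  information; finitely many spaces always embed into one, namely their direct sum.

  The scalars form a \<^class>\<open>real_normed_field\<close>; by Gelfand--Mazur this is \<open>\<real>\<close> or \<open>\<complex>\<close>.
\<close>

record ('k, 'u) nspace =
  scl :: "'k \<Rightarrow> 'u \<Rightarrow> 'u"
  car :: "'u set"
  nrm :: "'u \<Rightarrow> real"

definition normed_space :: "('k::real_normed_field, 'u::ab_group_add) nspace \<Rightarrow> bool" where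
  "normed_space X \<longleftrightarrow>
     vector_space (scl X) \<and> module.subspace (scl X) (car X) \<and>
     (\<forall>x\<in>car X. 0 \<le> nrm X x \<and> (nrm X x = 0 \<longleftrightarrow> x = 0)) \<and>
     (\<forall>x\<in>car X. \<forall>y\<in>car X. nrm X (x + y) \<le> nrm X x + nrm X y) \<and>
     (\<forall>c. \<forall>x\<in>car X. nrm X (scl X c x) = norm c * nrm X x)"

definition banach_space :: "('k::real_normed_field, 'u::ab_group_add) nspace \<Rightarrow> bool" where
  "banach_space X \<longleftrightarrow>
     normed_space X \<and>
     (\<forall>\<sigma> :: nat \<Rightarrow> 'u. (\<forall>i. \<sigma> i \<in> car X) \<longrightarrow>
        (\<forall>e>0. \<exists>N. \<forall>i\<ge>N. \<forall>j\<ge>N. nrm X (\<sigma> i - \<sigma> j) < e) \<longrightarrow>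
        (\<exists>x\<in>car X. (\<lambda>i. nrm X (\<sigma> i - x)) \<longlonglongrightarrow> 0))"

definition bdd_linear ::
    "('k::real_normed_field, 'u::ab_group_add) nspace \<Rightarrow> ('k, 'v::ab_group_add) nspace
      \<Rightarrow> ('u \<Rightarrow> 'v) \<Rightarrow> bool" where
  "bdd_linear X Y f \<longleftrightarrow>
     (\<forall>x\<in>car X. f x \<in> car Y) \<and>
     (\<forall>x\<in>car X. \<forall>y\<in>car X. f (x + y) = f x + f y) \<and>
     (\<forall>c. \<forall>x\<in>car X. f (scl X c x) = scl Y c (f x)) \<and>
     (\<exists>C. \<forall>x\<in>car X. nrm Y (f x) \<le> C * nrm X x)"

definition bdd_bilinear ::
    "('k::real_normed_field, 'u::ab_group_add) nspace \<Rightarrow> ('k, 'v::ab_group_add) nspace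
      \<Rightarrow> ('k, 'w::ab_group_add) nspace \<Rightarrow> ('u \<Rightarrow> 'v \<Rightarrow> 'w) \<Rightarrow> bool" where
  "bdd_bilinear X Y Z b \<longleftrightarrow>
     (\<forall>x\<in>car X. \<forall>y\<in>car Y. b x y \<in> car Z) \<and>
     (\<forall>x\<in>car X. \<forall>x'\<in>car X. \<forall>y\<in>car Y. b (x + x') y = b x y + b x' y) \<and>
     (\<forall>x\<in>car X. \<forall>y\<in>car Y. \<forall>y'\<in>car Y. b x (y + y') = b x y + b x y') \<and>
     (\<forall>c. \<forall>x\<in>car X. \<forall>y\<in>car Y. b (scl X c x) y = scl Z c (b x y)) \<and>
     (\<forall>c. \<forall>x\<in>car X. \<forall>y\<in>car Y. b x (scl Y c y) = scl Z c (b x y)) \<and>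
     (\<exists>C. \<forall>x\<in>car X. \<forall>y\<in>car Y. nrm Z (b x y) \<le> C * nrm X x * nrm Y y)"

definition scalars :: "('k::real_normed_field, 'k) nspace" where
  "scalars = \<lparr>scl = (*), car = UNIV, nrm = norm\<rparr>"


section \<open>Duals and iterated duals\<close>

text \<open>
  \<open>is_dual X Y p\<close>: the map \<open>f \<mapsto> p f\<close> is an isometric linear isomorphism from \<open>Y\<close> onto the
  space of all bounded linear functionals on \<open>X\<close> with the operator norm. Here \<open>p f x\<close> is
  \<open>\<langle>f, x\<rangle>\<close>.
\<close>

definition is_dual ::
    "('k::real_normed_field, 'u::ab_group_add) nspace \<Rightarrow> ('k, 'u) nspace
      \<Rightarrow> ('u \<Rightarrow> 'u \<Rightarrow> 'k) \<Rightarrow> bool" where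
  "is_dual X Y p \<longleftrightarrow>
     vector_space (scl Y) \<and> module.subspace (scl Y) (car Y) \<and>
     (\<forall>f\<in>car Y. bdd_linear X scalars (p f)) \<and>
     (\<forall>f\<in>car Y. \<forall>g\<in>car Y. \<forall>x\<in>car X. p (f + g) x = p f x + p g x) \<and>
     (\<forall>c. \<forall>f\<in>car Y. \<forall>x\<in>car X. p (scl Y c f) x = c * p f x) \<and>
     (\<forall>\<phi>. bdd_linear X scalars \<phi> \<longrightarrow> (\<exists>!f. f \<in> car Y \<and> (\<forall>x\<in>car X. p f x = \<phi> x))) \<and>
     (\<forall>f\<in>car Y. nrm Y f = (SUP x\<in>{x \<in> car X. nrm X x \<le> 1}. norm (p f x)))"

text \<open>
  \<open>dual_tower N X p\<close>: \<open>X 0\<close> is a Banach space and \<open>X 1, \<dots>, X N\<close> are its iterated duals,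
  \<open>p k\<close> being the pairing of \<open>X (k + 1)\<close> with \<open>X k\<close>. The bound \<open>N\<close> matters: for an
  infinite-dimensional space, HOL cannot be expected to have one type containing all the iterated
  duals at once. For each \<open>N\<close> towers do exist over every Banach space: see
  \<open>dual_tower_extend\<close> below.
\<close>

definition dual_tower ::
    "nat \<Rightarrow> (nat \<Rightarrow> ('k::real_normed_field, 'u::ab_group_add) nspace)
      \<Rightarrow> (nat \<Rightarrow> 'u \<Rightarrow> 'u \<Rightarrow> 'k) \<Rightarrow> bool" where
  "dual_tower N X p \<longleftrightarrow>
     banach_space (X 0) \<and> (\<forall>k<N. is_dual (X k) (X (Suc k)) (p k))"

text \<open>The element of the dual \<open>Y\<close> of \<open>X\<close> representing the functional \<open>\<phi>\<close>.\<close>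

definition represent ::
    "('k, 'u) nspace \<Rightarrow> ('k, 'v) nspace \<Rightarrow> ('v \<Rightarrow> 'u \<Rightarrow> 'k) \<Rightarrow> ('u \<Rightarrow> 'k) \<Rightarrow> 'v" where
  "represent X Y p \<phi> = (THE f. f \<in> car Y \<and> (\<forall>x\<in>car X. p f x = \<phi> x))"


section \<open>Banach algebras, bimodules and derivations\<close>

definition banach_algebra ::
    "('k::real_normed_field, 'u::ab_group_add) nspace \<Rightarrow> ('u \<Rightarrow> 'u \<Rightarrow> 'u) \<Rightarrow> bool" where
  "banach_algebra A m \<longleftrightarrow>
     banach_space A \<and> bdd_bilinear A A A m \<and>
     (\<forall>a\<in>car A. \<forall>b\<in>car A. \<forall>c\<in>car A. m (m a b) c = m a (m b c)) \<and>
     (\<forall>a\<in>car A. \<forall>b\<in>car A. nrm A (m a b) \<le> nrm A a * nrm A b)"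

definition banach_bimodule ::
    "('k::real_normed_field, 'c::ab_group_add) nspace \<Rightarrow> ('c \<Rightarrow> 'c \<Rightarrow> 'c)
      \<Rightarrow> ('k, 'u::ab_group_add) nspace \<Rightarrow> ('c \<Rightarrow> 'u \<Rightarrow> 'u) \<Rightarrow> ('u \<Rightarrow> 'c \<Rightarrow> 'u) \<Rightarrow> bool" where
  "banach_bimodule C m X l r \<longleftrightarrow>
     banach_space X \<and> bdd_bilinear C X X l \<and> bdd_bilinear X C X r \<and>
     (\<forall>c\<in>car C. \<forall>d\<in>car C. \<forall>x\<in>car X. l (m c d) x = l c (l d x)) \<and>
     (\<forall>c\<in>car C. \<forall>d\<in>car C. \<forall>x\<in>car X. r x (m c d) = r (r x c) d) \<and>
     (\<forall>c\<in>car C. \<forall>d\<in>car C. \<forall>x\<in>car X. r (l c x) d = l c (r x d))"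

definition derivation ::
    "('k::real_normed_field, 'c::ab_group_add) nspace \<Rightarrow> ('c \<Rightarrow> 'c \<Rightarrow> 'c)
      \<Rightarrow> ('k, 'u::ab_group_add) nspace \<Rightarrow> ('c \<Rightarrow> 'u \<Rightarrow> 'u) \<Rightarrow> ('u \<Rightarrow> 'c \<Rightarrow> 'u)
      \<Rightarrow> ('c \<Rightarrow> 'u) \<Rightarrow> bool" where
  "derivation C m X l r D \<longleftrightarrow>
     bdd_linear C X D \<and> (\<forall>c\<in>car C. \<forall>d\<in>car C. D (m c d) = r (D c) d + l c (D d))"

text \<open>
  The left and right action on \<open>X k\<close> obtained by \<open>k\<close>-fold dualization of actions \<open>l\<close>, \<open>r\<close> on
  \<open>X 0\<close>: \<open>\<langle>c \<cdot> f, x\<rangle> = \<langle>f, x \<cdot> c\<rangle>\<close> and \<open>\<langle>f \<cdot> c, x\<rangle> = \<langle>f, c \<cdot> x\<rangle>\<close>.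
\<close>

primrec dual_action ::
    "(nat \<Rightarrow> ('k, 'u) nspace) \<Rightarrow> (nat \<Rightarrow> 'u \<Rightarrow> 'u \<Rightarrow> 'k) \<Rightarrow> ('c \<Rightarrow> 'u \<Rightarrow> 'u) \<Rightarrow> ('u \<Rightarrow> 'c \<Rightarrow> 'u)
      \<Rightarrow> nat \<Rightarrow> ('c \<Rightarrow> 'u \<Rightarrow> 'u) \<times> ('u \<Rightarrow> 'c \<Rightarrow> 'u)" where
  "dual_action X p l r 0 = (l, r)"
| "dual_action X p l r (Suc k) =
     ((\<lambda>c f. represent (X k) (X (Suc k)) (p k) (\<lambda>x. p k f (snd (dual_action X p l r k) x c))),
      (\<lambda>f c. represent (X k) (X (Suc k)) (p k) (\<lambda>x. p k f (fst (dual_action X p l r k) c x))))"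

definition lact ::
    "(nat \<Rightarrow> ('k, 'u) nspace) \<Rightarrow> (nat \<Rightarrow> 'u \<Rightarrow> 'u \<Rightarrow> 'k) \<Rightarrow> ('c \<Rightarrow> 'u \<Rightarrow> 'u) \<Rightarrow> ('u \<Rightarrow> 'c \<Rightarrow> 'u)
      \<Rightarrow> nat \<Rightarrow> 'c \<Rightarrow> 'u \<Rightarrow> 'u" where
  "lact X p l r k = fst (dual_action X p l r k)"

definition ract ::
    "(nat \<Rightarrow> ('k, 'u) nspace) \<Rightarrow> (nat \<Rightarrow> 'u \<Rightarrow> 'u \<Rightarrow> 'k) \<Rightarrow> ('c \<Rightarrow> 'u \<Rightarrow> 'u) \<Rightarrow> ('u \<Rightarrow> 'c \<Rightarrow> 'u)
      \<Rightarrow> nat \<Rightarrow> 'u \<Rightarrow> 'c \<Rightarrow> 'u" where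
  "ract X p l r k = snd (dual_action X p l r k)"


section \<open>The amalgamated duplication\<close>

text \<open>
  In this section \<open>A\<close>, \<open>pA\<close> is the dual tower of the algebra \<open>\<A>\<close> with product \<open>mA\<close>, and \<open>B\<close>,
  \<open>pB\<close> that of \<open>\<AA>\<close> with product \<open>mB\<close>; \<open>l\<close> and \<open>r\<close> are the left and right action of \<open>\<AA>\<close> on
  \<open>\<A>\<close>.
\<close>

definition compatible_actions ::
    "('k, 'u) nspace \<Rightarrow> ('u \<Rightarrow> 'u \<Rightarrow> 'u) \<Rightarrow> ('k, 'v) nspace
      \<Rightarrow> ('v \<Rightarrow> 'u \<Rightarrow> 'u) \<Rightarrow> ('u \<Rightarrow> 'v \<Rightarrow> 'u) \<Rightarrow> bool" where
  "compatible_actions A0 mA B0 l r \<longleftrightarrow>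
     (\<forall>a\<in>car A0. \<forall>b\<in>car A0. \<forall>\<beta>\<in>car B0.
        l \<beta> (mA a b) = mA (l \<beta> a) b \<and>
        r (mA a b) \<beta> = mA a (r b \<beta>) \<and>
        mA a (l \<beta> b) = mA (r a \<beta>) b)"

fun dup_mult ::
    "('u::ab_group_add \<Rightarrow> 'u \<Rightarrow> 'u) \<Rightarrow> ('v \<Rightarrow> 'v \<Rightarrow> 'v) \<Rightarrow> ('v \<Rightarrow> 'u \<Rightarrow> 'u) \<Rightarrow> ('u \<Rightarrow> 'v \<Rightarrow> 'u)
      \<Rightarrow> 'u \<times> 'v \<Rightarrow> 'u \<times> 'v \<Rightarrow> 'u \<times> 'v" where
  "dup_mult mA mB l r (a, \<beta>) (b, \<gamma>) = (mA a b + r a \<gamma> + l \<beta> b, mB \<beta> \<gamma>)"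

text \<open>
  The space underlying the duplication and its iterated duals \<open>A k \<times> B k\<close>. The dual of a sum norm
  is a max norm and vice versa, so the norm alternates with the parity of \<open>k\<close>. That these spaces
  with the coordinatewise pairing are the iterated duals is \<open>dual_tower_dup\<close> below.
\<close>

definition nspace_prod ::
    "bool \<Rightarrow> ('k, 'u) nspace \<Rightarrow> ('k, 'v) nspace \<Rightarrow> ('k, 'u \<times> 'v) nspace" where
  "nspace_prod sum_norm X Y =
     \<lparr>scl = (\<lambda>c (x, y). (scl X c x, scl Y c y)),
      car = car X \<times> car Y,
      nrm = (\<lambda>(x, y). if sum_norm then nrm X x + nrm Y y else max (nrm X x) (nrm Y y))\<rparr>"

definition dup_space ::
    "(nat \<Rightarrow> ('k, 'u) nspace) \<Rightarrow> (nat \<Rightarrow> ('k, 'v) nspace) \<Rightarrow> nat \<Rightarrow> ('k, 'u \<times> 'v) nspace" where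
  "dup_space A B k = nspace_prod (even k) (A k) (B k)"

definition dup_pair ::
    "(nat \<Rightarrow> 'u \<Rightarrow> 'u \<Rightarrow> 'k::plus) \<Rightarrow> (nat \<Rightarrow> 'v \<Rightarrow> 'v \<Rightarrow> 'k)
      \<Rightarrow> nat \<Rightarrow> 'u \<times> 'v \<Rightarrow> 'u \<times> 'v \<Rightarrow> 'k" where
  "dup_pair pA pB k = (\<lambda>(f, g) (x, y). pA k f x + pB k g y)"

text \<open>
  The mixed operations of \<open>a\<close> in \<open>\<A>\<close>. A pair consists of the operation from the left and the one
  from the right; \<open>mixed_even\<close> at \<open>m\<close> takes \<open>y\<close> in \<open>B (2m)\<close> to elements of \<open>A (2m)\<close>, and
  \<open>mixed_odd\<close> at \<open>m\<close> takes \<open>x\<close> in \<open>A (2m + 1)\<close> to elements of \<open>B (2m + 1)\<close>.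
  \<open>mixed_odd_step\<close> obtains the latter from the former. \<open>lmix\<close> and \<open>rmix\<close> at \<open>m\<close> are the two
  operations at the odd level \<open>2m + 1\<close>.
\<close>

definition mixed_odd_step ::
    "(nat \<Rightarrow> 'u \<Rightarrow> 'u \<Rightarrow> 'k) \<Rightarrow> (nat \<Rightarrow> ('k, 'v) nspace) \<Rightarrow> (nat \<Rightarrow> 'v \<Rightarrow> 'v \<Rightarrow> 'k) \<Rightarrow> nat
      \<Rightarrow> ('u \<Rightarrow> 'v \<Rightarrow> 'u) \<times> ('v \<Rightarrow> 'u \<Rightarrow> 'u) \<Rightarrow> ('u \<Rightarrow> 'u \<Rightarrow> 'v) \<times> ('u \<Rightarrow> 'u \<Rightarrow> 'v)" where
  "mixed_odd_step pA B pB m E =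
     ((\<lambda>a x. represent (B (2*m)) (B (2*m+1)) (pB (2*m)) (\<lambda>y. pA (2*m) x (snd E y a))),
      (\<lambda>x a. represent (B (2*m)) (B (2*m+1)) (pB (2*m)) (\<lambda>y. pA (2*m) x (fst E a y))))"

primrec mixed_even ::
    "(nat \<Rightarrow> ('k, 'u) nspace) \<Rightarrow> (nat \<Rightarrow> 'u \<Rightarrow> 'u \<Rightarrow> 'k)
      \<Rightarrow> (nat \<Rightarrow> ('k, 'v) nspace) \<Rightarrow> (nat \<Rightarrow> 'v \<Rightarrow> 'v \<Rightarrow> 'k)
      \<Rightarrow> ('v \<Rightarrow> 'u \<Rightarrow> 'u) \<Rightarrow> ('u \<Rightarrow> 'v \<Rightarrow> 'u)
      \<Rightarrow> nat \<Rightarrow> ('u \<Rightarrow> 'v \<Rightarrow> 'u) \<times> ('v \<Rightarrow> 'u \<Rightarrow> 'u)" where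
  "mixed_even A pA B pB l r 0 = ((\<lambda>a y. r a y), (\<lambda>y a. l y a))"
| "mixed_even A pA B pB l r (Suc m) =
     (let O' = mixed_odd_step pA B pB m (mixed_even A pA B pB l r m) in
      ((\<lambda>a y. represent (A (2*m+1)) (A (2*m+2)) (pA (2*m+1)) (\<lambda>x. pB (2*m+1) y (snd O' x a))),
       (\<lambda>y a. represent (A (2*m+1)) (A (2*m+2)) (pA (2*m+1)) (\<lambda>x. pB (2*m+1) y (fst O' a x)))))"

definition mixed_odd ::
    "(nat \<Rightarrow> ('k, 'u) nspace) \<Rightarrow> (nat \<Rightarrow> 'u \<Rightarrow> 'u \<Rightarrow> 'k)
      \<Rightarrow> (nat \<Rightarrow> ('k, 'v) nspace) \<Rightarrow> (nat \<Rightarrow> 'v \<Rightarrow> 'v \<Rightarrow> 'k)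
      \<Rightarrow> ('v \<Rightarrow> 'u \<Rightarrow> 'u) \<Rightarrow> ('u \<Rightarrow> 'v \<Rightarrow> 'u)
      \<Rightarrow> nat \<Rightarrow> ('u \<Rightarrow> 'u \<Rightarrow> 'v) \<times> ('u \<Rightarrow> 'u \<Rightarrow> 'v)" where
  "mixed_odd A pA B pB l r m = mixed_odd_step pA B pB m (mixed_even A pA B pB l r m)"

definition lmix ::
    "(nat \<Rightarrow> ('k, 'u) nspace) \<Rightarrow> (nat \<Rightarrow> 'u \<Rightarrow> 'u \<Rightarrow> 'k)
      \<Rightarrow> (nat \<Rightarrow> ('k, 'v) nspace) \<Rightarrow> (nat \<Rightarrow> 'v \<Rightarrow> 'v \<Rightarrow> 'k)
      \<Rightarrow> ('v \<Rightarrow> 'u \<Rightarrow> 'u) \<Rightarrow> ('u \<Rightarrow> 'v \<Rightarrow> 'u) \<Rightarrow> nat \<Rightarrow> 'u \<Rightarrow> 'u \<Rightarrow> 'v" where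
  "lmix A pA B pB l r m = fst (mixed_odd A pA B pB l r m)"

definition rmix ::
    "(nat \<Rightarrow> ('k, 'u) nspace) \<Rightarrow> (nat \<Rightarrow> 'u \<Rightarrow> 'u \<Rightarrow> 'k)
      \<Rightarrow> (nat \<Rightarrow> ('k, 'v) nspace) \<Rightarrow> (nat \<Rightarrow> 'v \<Rightarrow> 'v \<Rightarrow> 'k)
      \<Rightarrow> ('v \<Rightarrow> 'u \<Rightarrow> 'u) \<Rightarrow> ('u \<Rightarrow> 'v \<Rightarrow> 'u) \<Rightarrow> nat \<Rightarrow> 'u \<Rightarrow> 'u \<Rightarrow> 'v" where
  "rmix A pA B pB l r m = snd (mixed_odd A pA B pB l r m)"


section \<open>Adequacy of the dual towers\<close>

lemma subspaceD:
  assumes "vector_space s" "module.subspace s S"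
  shows "0 \<in> S" "\<And>x y. x \<in> S \<Longrightarrow> y \<in> S \<Longrightarrow> x + y \<in> S" "\<And>c x. x \<in> S \<Longrightarrow> s c x \<in> S"
    "\<And>x y. x \<in> S \<Longrightarrow> y \<in> S \<Longrightarrow> x - y \<in> S"
proof -
  interpret vector_space s by fact
  show "0 \<in> S" "\<And>x y. x \<in> S \<Longrightarrow> y \<in> S \<Longrightarrow> x + y \<in> S" "\<And>c x. x \<in> S \<Longrightarrow> s c x \<in> S"
    "\<And>x y. x \<in> S \<Longrightarrow> y \<in> S \<Longrightarrow> x - y \<in> S"
    using assms(2) by (auto intro: subspace_0 subspace_add subspace_scale subspace_diff)
qed

lemma normed_spaceD:
  assumes "normed_space X"
  shows "0 \<in> car X" "\<And>x y. x \<in> car X \<Longrightarrow> y \<in> car X \<Longrightarrow> x + y \<in> car X"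
    "\<And>c x. x \<in> car X \<Longrightarrow> scl X c x \<in> car X" "\<And>x y. x \<in> car X \<Longrightarrow> y \<in> car X \<Longrightarrow> x - y \<in> car X"
    "nrm X 0 = 0" "\<And>x. x \<in> car X \<Longrightarrow> 0 \<le> nrm X x"
    "\<And>x y. x \<in> car X \<Longrightarrow> y \<in> car X \<Longrightarrow> nrm X (x + y) \<le> nrm X x + nrm X y"
    "\<And>c x. x \<in> car X \<Longrightarrow> nrm X (scl X c x) = norm c * nrm X x"
    "\<And>x. x \<in> car X \<Longrightarrow> nrm X x = 0 \<longleftrightarrow> x = 0"
    "\<And>c. scl X c 0 = 0" "\<And>x. scl X 1 x = x"
proof -
  have v: "vector_space (scl X)" "module.subspace (scl X) (car X)"
    using assms by (auto simp: normed_space_def)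
  interpret vector_space "scl X" by fact
  show "0 \<in> car X" "\<And>x y. x \<in> car X \<Longrightarrow> y \<in> car X \<Longrightarrow> x + y \<in> car X"
    "\<And>c x. x \<in> car X \<Longrightarrow> scl X c x \<in> car X" "\<And>x y. x \<in> car X \<Longrightarrow> y \<in> car X \<Longrightarrow> x - y \<in> car X"
    using subspaceD[OF v] by auto
  then show "nrm X 0 = 0" "\<And>x. x \<in> car X \<Longrightarrow> 0 \<le> nrm X x"
    "\<And>x y. x \<in> car X \<Longrightarrow> y \<in> car X \<Longrightarrow> nrm X (x + y) \<le> nrm X x + nrm X y"
    "\<And>c x. x \<in> car X \<Longrightarrow> nrm X (scl X c x) = norm c * nrm X x"
    "\<And>x. x \<in> car X \<Longrightarrow> nrm X x = 0 \<longleftrightarrow> x = 0"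
    using assms by (auto simp: normed_space_def)
  show "\<And>c. scl X c 0 = 0" "\<And>x. scl X 1 x = x" by auto
qed

lemma functionalD:
  assumes "bdd_linear X scalars \<phi>"
  shows "\<And>x y. x \<in> car X \<Longrightarrow> y \<in> car X \<Longrightarrow> \<phi> (x + y) = \<phi> x + \<phi> y"
    "\<And>c x. x \<in> car X \<Longrightarrow> \<phi> (scl X c x) = c * \<phi> x"
    "\<exists>C. \<forall>x\<in>car X. norm (\<phi> x) \<le> C * nrm X x"
  using assms by (simp_all add: bdd_linear_def scalars_def)

lemma functionalI:
  assumes "\<And>x y. x \<in> car X \<Longrightarrow> y \<in> car X \<Longrightarrow> \<phi> (x + y) = \<phi> x + \<phi> y"
    and "\<And>c x. x \<in> car X \<Longrightarrow> \<phi> (scl X c x) = c * \<phi> x"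
    and "\<And>x. x \<in> car X \<Longrightarrow> norm (\<phi> x) \<le> C * nrm X x"
  shows "bdd_linear X scalars \<phi>"
proof -
  have "\<exists>C. \<forall>x\<in>car X. norm (\<phi> x) \<le> C * nrm X x" using assms(3) by blast
  then show ?thesis using assms(1,2) by (simp add: bdd_linear_def scalars_def)
qed

lemma functional_0:
  assumes "normed_space X" "bdd_linear X scalars \<phi>"
  shows "\<phi> 0 = 0"
  using assms(2) normed_spaceD(1,10,3)[OF assms(1)]
  by (auto simp: bdd_linear_def scalars_def) (metis mult_zero_left)

lemma opnorm_bdd:
  assumes "normed_space X" "bdd_linear X scalars \<phi>"
  shows "bdd_above ((\<lambda>x. norm (\<phi> x)) ` {x \<in> car X. nrm X x \<le> 1})"
proof -
  obtain C where C: "\<And>x. x \<in> car X \<Longrightarrow> norm (\<phi> x) \<le> C * nrm X x"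
    using assms(2) unfolding bdd_linear_def scalars_def by auto metis
  have "norm (\<phi> x) \<le> \<bar>C\<bar>" if "x \<in> car X" "nrm X x \<le> 1" for x
  proof -
    have "norm (\<phi> x) \<le> \<bar>C\<bar> * nrm X x"
      using C[OF that(1)] normed_spaceD(6)[OF assms(1) that(1)]
      by (meson abs_ge_self mult_right_mono order_trans)
    also have "\<dots> \<le> \<bar>C\<bar> * 1" using that by (intro mult_left_mono) auto
    finally show ?thesis by simp
  qed
  then show ?thesis by (auto intro!: bdd_aboveI)
qed

lemma opnorm_upper:
  assumes "normed_space X" "bdd_linear X scalars \<phi>" "x \<in> car X"
  shows "norm (\<phi> x) \<le> (SUP x\<in>{x \<in> car X. nrm X x \<le> 1}. norm (\<phi> x)) * nrm X x"
proof (cases "x = 0")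
  case True
  then show ?thesis using functional_0[OF assms(1,2)] normed_spaceD(5)[OF assms(1)] by simp
next
  case False
  let ?t = "of_real (inverse (nrm X x)) :: 'a"
  have pos: "nrm X x > 0"
    using False normed_spaceD(6,9)[OF assms(1,3)] by linarith
  have mem: "scl X ?t x \<in> {x \<in> car X. nrm X x \<le> 1}"
    using normed_spaceD(3)[OF assms(1,3)] normed_spaceD(8)[OF assms(1,3), of ?t] pos by (simp add: norm_inverse)
  have "norm (\<phi> (scl X ?t x)) \<le> (SUP x\<in>{x \<in> car X. nrm X x \<le> 1}. norm (\<phi> x))"
    by (rule cSUP_upper[OF mem opnorm_bdd[OF assms(1,2)]])
  moreover have "\<phi> (scl X ?t x) = ?t * \<phi> x"
    using assms(2,3) by (auto simp: bdd_linear_def scalars_def)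
  ultimately have "norm ?t * norm (\<phi> x) \<le> (SUP x\<in>{x \<in> car X. nrm X x \<le> 1}. norm (\<phi> x))"
    by (simp add: norm_mult)
  moreover have "norm ?t = inverse (nrm X x)" using pos by (simp add: norm_inverse)
  ultimately show ?thesis 
    using pos pos_divide_le_eq[OF pos, of "norm (\<phi> x)"] by (simp add: divide_inverse mult.commute)
qed

lemma opnorm_least:
  assumes "normed_space X" "\<And>x. x \<in> car X \<Longrightarrow> nrm X x \<le> 1 \<Longrightarrow> norm (\<phi> x) \<le> M"
  shows "(SUP x\<in>{x \<in> car X. nrm X x \<le> 1}. norm (\<phi> x)) \<le> M"
  using assms(2) normed_spaceD(1,5)[OF assms(1)] by (intro cSUP_least) auto

lemma opnorm_nonneg:
  assumes "normed_space X" "bdd_linear X scalars \<phi>"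
  shows "0 \<le> (SUP x\<in>{x \<in> car X. nrm X x \<le> 1}. norm (\<phi> x))"
  using normed_spaceD(1,5)[OF assms(1)]
  by (intro cSUP_upper2[OF opnorm_bdd[OF assms], of 0]) auto

lemma is_dualD:
  assumes "is_dual X Y p"
  shows "vector_space (scl Y)" "module.subspace (scl Y) (car Y)"
    "\<And>f. f \<in> car Y \<Longrightarrow> bdd_linear X scalars (p f)"
    "\<And>f g x. f \<in> car Y \<Longrightarrow> g \<in> car Y \<Longrightarrow> x \<in> car X \<Longrightarrow> p (f + g) x = p f x + p g x"
    "\<And>c f x. f \<in> car Y \<Longrightarrow> x \<in> car X \<Longrightarrow> p (scl Y c f) x = c * p f x"
    "\<And>\<phi>. bdd_linear X scalars \<phi> \<Longrightarrow> \<exists>!f. f \<in> car Y \<and> (\<forall>x\<in>car X. p f x = \<phi> x)"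
    "\<And>f. f \<in> car Y \<Longrightarrow> nrm Y f = (SUP x\<in>{x \<in> car X. nrm X x \<le> 1}. norm (p f x))"
  using assms unfolding is_dual_def by blast+

lemma is_dual_normed_space:
  assumes "normed_space X" "is_dual X Y p"
  shows "normed_space Y"
proof -
  let ?S = "\<lambda>f. SUP x\<in>{x \<in> car X. nrm X x \<le> 1}. norm (p f x)"
  note v = is_dualD(1,2)[OF assms(2)] and bl = is_dualD(3)[OF assms(2)]
    and ad = is_dualD(4)[OF assms(2)] and sc = is_dualD(5)[OF assms(2)]
    and ex = is_dualD(6)[OF assms(2)] and nm = is_dualD(7)[OF assms(2)]
  note sub = subspaceD[OF v]
  have bound: "norm (p f x) \<le> nrm Y f" if "f \<in> car Y" "x \<in> car X" "nrm X x \<le> 1" for f x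
    unfolding nm[OF that(1)] using that(2,3) opnorm_bdd[OF assms(1) bl[OF that(1)]]
    by (intro cSUP_upper) auto
  have nn: "0 \<le> nrm Y f" if "f \<in> car Y" for f
    unfolding nm[OF that] by (rule opnorm_nonneg[OF assms(1) bl[OF that]])
  have p0: "p 0 x = 0" if "x \<in> car X" for x
    using ad[OF sub(1) sub(1) that] by simp
  have z: "f = 0" if "f \<in> car Y" "nrm Y f = 0" for f
  proof -
    have "p f x = 0" if x: "x \<in> car X" for x
      using opnorm_upper[OF assms(1) bl[OF \<open>f \<in> car Y\<close>] x] nm[OF \<open>f \<in> car Y\<close>] \<open>nrm Y f = 0\<close>
      by simp
    then show ?thesis using ex[OF bl[OF sub(1)]] p0 \<open>f \<in> car Y\<close> sub(1) by metis
  qed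
  have "nrm Y 0 \<le> 0"
    unfolding nm[OF sub(1)] by (rule opnorm_least[OF assms(1)]) (simp add: p0)
  then have n0: "nrm Y 0 = 0" using nn[OF sub(1)] by simp
  have tri: "nrm Y (f + g) \<le> nrm Y f + nrm Y g" if "f \<in> car Y" "g \<in> car Y" for f g
    unfolding nm[OF sub(2)[OF that]]
  proof (rule opnorm_least[OF assms(1)])
    fix x assume x: "x \<in> car X" "nrm X x \<le> 1"
    show "norm (p (f + g) x) \<le> nrm Y f + nrm Y g"
      using ad[OF that x(1)] norm_triangle_ineq[of "p f x" "p g x"]
        bound[OF that(1) x] bound[OF that(2) x] by simp
  qed
  have hle: "nrm Y (scl Y c f) \<le> norm c * nrm Y f" if "f \<in> car Y" for c f
    unfolding nm[OF sub(3)[OF that]]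
  proof (rule opnorm_least[OF assms(1)])
    fix x assume x: "x \<in> car X" "nrm X x \<le> 1"
    show "norm (p (scl Y c f) x) \<le> norm c * nrm Y f"
      using sc[OF that x(1)] bound[OF that x] by (simp add: norm_mult mult_left_mono)
  qed
  interpret Y: vector_space "scl Y" by fact
  have hom: "nrm Y (scl Y c f) = norm c * nrm Y f" if f: "f \<in> car Y" for c f
  proof (cases "c = 0")
    case True
    then show ?thesis using n0 by simp
  next
    case False
    have "nrm Y f = nrm Y (scl Y (inverse c) (scl Y c f))" using False by simp
    also have "\<dots> \<le> norm (inverse c) * nrm Y (scl Y c f)" by (rule hle[OF sub(3)[OF f]])
    finally have "norm c * nrm Y f \<le> nrm Y (scl Y c f)"
      using False by (simp add: norm_inverse norm_divide field_simps)
    then show ?thesis using hle[OF f, of c] by simp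
  qed
  show ?thesis
    unfolding normed_space_def using v nn z n0 tri hom by blast
qed

lemma dual_tower_normed_space:
  assumes "dual_tower N X p" "k \<le> N"
  shows "normed_space (X k)"
  using assms(2)
proof (induction k)
  case 0
  then show ?case using assms(1) by (simp add: dual_tower_def banach_space_def)
next
  case (Suc k)
  then show ?case using assms(1) is_dual_normed_space[of "X k" "X (Suc k)" "p k"]
    by (simp add: dual_tower_def)
qed


lemma vector_space_prod:
  assumes "vector_space (scl A)" "vector_space (scl B)"
  shows "vector_space (scl (nspace_prod e A B))"
proof -
  interpret AA: vector_space "scl A" by fact
  interpret BB: vector_space "scl B" by fact
  show ?thesis
    by unfold_locales
      (auto simp: nspace_prod_def AA.scale_right_distrib BB.scale_right_distrib
        AA.scale_left_distrib BB.scale_left_distrib)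
qed

lemma subspace_prod:
  assumes "vector_space (scl A)" "vector_space (scl B)"
    and "module.subspace (scl A) (car A)" "module.subspace (scl B) (car B)"
  shows "module.subspace (scl (nspace_prod e A B)) (car (nspace_prod e A B))"
proof -
  interpret vector_space "scl (nspace_prod e A B)" by (rule vector_space_prod[OF assms(1,2)])
  show ?thesis
    using subspaceD[OF assms(1,3)] subspaceD[OF assms(2,4)]
    by (intro subspaceI) (auto simp: nspace_prod_def zero_prod_def)
qed

lemma normed_space_prod:
  assumes "normed_space A" "normed_space B"
  shows "normed_space (nspace_prod e A B)"
proof -
  note AA = normed_spaceD[OF assms(1)] and BB = normed_spaceD[OF assms(2)]
  have v: "vector_space (scl (nspace_prod e A B))"
    "module.subspace (scl (nspace_prod e A B)) (car (nspace_prod e A B))"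
    using vector_space_prod subspace_prod assms by (auto simp: normed_space_def)
  show ?thesis
    unfolding normed_space_def
  proof (intro conjI v ballI allI)
    fix z assume "z \<in> car (nspace_prod e A B)"
    then obtain x y where z: "z = (x, y)" "x \<in> car A" "y \<in> car B"
      by (auto simp: nspace_prod_def)
    have nn: "0 \<le> nrm A x" "0 \<le> nrm B y" using AA(6) BB(6) z by auto
    then show "0 \<le> nrm (nspace_prod e A B) z" using z by (auto simp: nspace_prod_def)
    have "nrm (nspace_prod e A B) z = 0 \<longleftrightarrow> nrm A x = 0 \<and> nrm B y = 0"
      using nn z by (auto simp: nspace_prod_def max_def)
    then show "nrm (nspace_prod e A B) z = 0 \<longleftrightarrow> z = 0"
      using AA(9) BB(9) z by (simp add: zero_prod_def)
    show "nrm (nspace_prod e A B) (scl (nspace_prod e A B) c z) = norm c * nrm (nspace_prod e A B) z" for c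
      using AA(8) BB(8) z by (simp add: nspace_prod_def distrib_left max_mult_distrib_left)
    fix w assume "w \<in> car (nspace_prod e A B)"
    then obtain x' y' where w: "w = (x', y')" "x' \<in> car A" "y' \<in> car B"
      by (auto simp: nspace_prod_def)
    show "nrm (nspace_prod e A B) (z + w) \<le> nrm (nspace_prod e A B) z + nrm (nspace_prod e A B) w"
      using AA(7)[OF z(2) w(2)] BB(7)[OF z(3) w(3)] z w by (auto simp: nspace_prod_def max_def)
  qed
qed

lemma banach_space_prod:
  assumes "banach_space A" "banach_space B"
  shows "banach_space (nspace_prod True A B)"
proof -
  have n: "normed_space A" "normed_space B" using assms by (auto simp: banach_space_def)
  note AA = normed_spaceD[OF n(1)] and BB = normed_spaceD[OF n(2)]
  have c: "\<exists>x\<in>car (nspace_prod True A B). (\<lambda>i. nrm (nspace_prod True A B) (\<sigma> i - x)) \<longlonglongrightarrow> 0"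
    if mem: "\<forall>i. \<sigma> i \<in> car (nspace_prod True A B)"
      and cau: "\<forall>e>0. \<exists>N. \<forall>i\<ge>N. \<forall>j\<ge>N. nrm (nspace_prod True A B) (\<sigma> i - \<sigma> j) < e"
    for \<sigma> :: "nat \<Rightarrow> 'b \<times> 'c"
  proof -
    define f g where "f i = fst (\<sigma> i)" and "g i = snd (\<sigma> i)" for i
    have s: "\<sigma> i = (f i, g i)" for i by (simp add: f_def g_def)
    have m: "f i \<in> car A" "g i \<in> car B" for i
      using mem s by (auto simp: nspace_prod_def)
    have le: "nrm A (f i - f j) \<le> nrm (nspace_prod True A B) (\<sigma> i - \<sigma> j)"
      "nrm B (g i - g j) \<le> nrm (nspace_prod True A B) (\<sigma> i - \<sigma> j)" for i j
      using AA(6)[OF AA(4)[OF m(1) m(1)]] BB(6)[OF BB(4)[OF m(2) m(2)]]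
      by (auto simp: nspace_prod_def s)
    have "\<forall>e>0. \<exists>N. \<forall>i\<ge>N. \<forall>j\<ge>N. nrm A (f i - f j) < e"
      using cau le(1) by (meson order_le_less_trans)
    then obtain x where x: "x \<in> car A" "(\<lambda>i. nrm A (f i - x)) \<longlonglongrightarrow> 0"
      using assms(1) m unfolding banach_space_def by blast
    have "\<forall>e>0. \<exists>N. \<forall>i\<ge>N. \<forall>j\<ge>N. nrm B (g i - g j) < e"
      using cau le(2) by (meson order_le_less_trans)
    then obtain y where y: "y \<in> car B" "(\<lambda>i. nrm B (g i - y)) \<longlonglongrightarrow> 0"
      using assms(2) m unfolding banach_space_def by blast
    show ?thesis
      using x y tendsto_add[OF x(2) y(2)] by (intro bexI[of _ "(x, y)"]) (auto simp: nspace_prod_def s)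
  qed
  then show ?thesis
    unfolding banach_space_def using normed_space_prod[OF n] by blast
qed

lemma ex_unit_scalar: "\<exists>c::'k::real_normed_field. norm c = 1 \<and> c * t = of_real (norm t)"
proof (cases "t = 0")
  case False
  then show ?thesis
    by (intro exI[of _ "of_real (norm t) / t"]) (simp add: norm_divide)
qed (auto intro: exI[of _ 1])

lemma is_dual_prod:
  assumes "normed_space A" "normed_space B"
    and "is_dual A A' p" "is_dual B B' q"
  shows "is_dual (nspace_prod e A B) (nspace_prod (\<not> e) A' B') (\<lambda>(f, g) (x, y). p f x + q g y)"
proof -
  let ?X = "nspace_prod e A B" and ?Y = "nspace_prod (\<not> e) A' B'" and ?p = "\<lambda>(f, g) (x, y). p f x + q g y"
  note AA = normed_spaceD[OF assms(1)] and BB = normed_spaceD[OF assms(2)]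
  note X = normed_space_prod[where A = A and B = B and e = e, OF assms(1,2)]
  note v = is_dualD(1,2)[OF assms(3)] is_dualD(1,2)[OF assms(4)]
    and blA = is_dualD(3)[OF assms(3)] and blB = is_dualD(3)[OF assms(4)]
    and adA = is_dualD(4)[OF assms(3)] and adB = is_dualD(4)[OF assms(4)]
    and scA = is_dualD(5)[OF assms(3)] and scB = is_dualD(5)[OF assms(4)]
    and exA = is_dualD(6)[OF assms(3)] and exB = is_dualD(6)[OF assms(4)]
    and nmA = is_dualD(7)[OF assms(3)] and nmB = is_dualD(7)[OF assms(4)]
  have carX: "car ?X = car A \<times> car B" by (simp add: nspace_prod_def)
  have bdA: "norm (p f x) \<le> nrm A' f * nrm A x"
    if "f \<in> car A'" "x \<in> car A" for f x
    unfolding nmA[OF that(1)] by (rule opnorm_upper[OF assms(1) blA[OF that(1)] that(2)])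
  have bdB: "norm (q f x) \<le> nrm B' f * nrm B x"
    if "f \<in> car B'" "x \<in> car B" for f x
    unfolding nmB[OF that(1)] by (rule opnorm_upper[OF assms(2) blB[OF that(1)] that(2)])
  have nnA: "0 \<le> nrm A' f" if "f \<in> car A'" for f
    unfolding nmA[OF that] by (rule opnorm_nonneg[OF assms(1) blA[OF that]])
  have nnB: "0 \<le> nrm B' f" if "f \<in> car B'" for f
    unfolding nmB[OF that] by (rule opnorm_nonneg[OF assms(2) blB[OF that]])
  note linA = functionalD(1,2)[OF blA] and linB = functionalD(1,2)[OF blB]
  have pair_le: "norm (p f x + q g y) \<le> nrm ?Y (f, g) * nrm ?X (x, y)"
    if "f \<in> car A'" "g \<in> car B'" "x \<in> car A" "y \<in> car B" for f g x y
  proof -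
    have "norm (p f x + q g y) \<le>
        nrm A' f * nrm A x + nrm B' g * nrm B y"
      using bdA[OF that(1,3)] bdB[OF that(2,4)] norm_triangle_ineq[of "p f x" "q g y"]
      by linarith
    also have "\<dots> \<le> nrm ?Y (f, g) * nrm ?X (x, y)"
    proof (cases "e")
      case True
      have "nrm A' f * nrm A x + nrm B' g * nrm B y \<le>
        max (nrm A' f) (nrm B' g) * nrm A x +
        max (nrm A' f) (nrm B' g) * nrm B y"
        using AA(6)[OF that(3)] BB(6)[OF that(4)] by (intro add_mono mult_right_mono) auto
      then show ?thesis using True by (simp add: nspace_prod_def distrib_left)
    next
      case False
      have "nrm A' f * nrm A x + nrm B' g * nrm B y \<le>
        nrm A' f * max (nrm A x) (nrm B y) +
        nrm B' g * max (nrm A x) (nrm B y)"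
        using nnA[OF that(1)] nnB[OF that(2)] by (intro add_mono mult_left_mono) auto
      then show ?thesis using False by (simp add: nspace_prod_def distrib_right)
    qed
    finally show ?thesis .
  qed
  have bl: "bdd_linear ?X scalars (?p h)" if hY: "h \<in> car ?Y" for h
  proof -
    obtain f g where h: "h = (f, g)" "f \<in> car A'" "g \<in> car B'"
      using hY by (auto simp: nspace_prod_def)
    show ?thesis
    proof (rule functionalI[where C = "nrm ?Y h"])
      show "?p h (z + w) = ?p h z + ?p h w" if "z \<in> car ?X" "w \<in> car ?X" for z w
        using that linA(1)[OF h(2)] linB(1)[OF h(3)] by (auto simp: h(1) carX)
      show "?p h (scl ?X c z) = c * ?p h z" if "z \<in> car ?X" for c z
        using that linA(2)[OF h(2)] linB(2)[OF h(3)]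
        by (auto simp: h(1) nspace_prod_def distrib_left)
      show "norm (?p h z) \<le> nrm ?Y h * nrm ?X z" if "z \<in> car ?X" for z
        using that pair_le[OF h(2,3)] by (auto simp: h(1) carX)
    qed
  qed
  have "\<exists>!h. h \<in> car ?Y \<and> (\<forall>z\<in>car ?X. ?p h z = \<phi> z)" if \<phi>: "bdd_linear ?X scalars \<phi>" for \<phi>
  proof -
    have add: "\<phi> (x + x', y + y') = \<phi> (x, y) + \<phi> (x', y')"
      if "x \<in> car A" "y \<in> car B" "x' \<in> car A" "y' \<in> car B" for x y x' y'
      using functionalD(1)[OF \<phi>, of "(x, y)" "(x', y')"] that by (simp add: carX)
    have hom: "\<phi> (scl A c x, scl B c y) = c * \<phi> (x, y)" if "x \<in> car A" "y \<in> car B" for c x y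
      using functionalD(2)[OF \<phi>, of "(x, y)"] that by (simp add: nspace_prod_def)
    obtain C where C: "\<And>z. z \<in> car ?X \<Longrightarrow> norm (\<phi> z) \<le> C * nrm ?X z"
      using functionalD(3)[OF \<phi>] by blast
    have n1: "nrm ?X (x, 0) = nrm A x" if "x \<in> car A" for x
      using AA(6)[OF that] BB(5) by (simp add: nspace_prod_def)
    have n2: "nrm ?X (0, y) = nrm B y" if "y \<in> car B" for y
      using BB(6)[OF that] AA(5) by (simp add: nspace_prod_def)
    have "bdd_linear A scalars (\<lambda>x. \<phi> (x, 0))"
    proof (rule functionalI)
      show "\<phi> (x + y, 0) = \<phi> (x, 0) + \<phi> (y, 0)" if "x \<in> car A" "y \<in> car A" for x y
        using add[OF that(1) BB(1) that(2) BB(1)] by simp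
      show "\<phi> (scl A c x, 0) = c * \<phi> (x, 0)" if "x \<in> car A" for c x
        using hom[OF that BB(1), of c] BB(10) by simp
      show "norm (\<phi> (x, 0)) \<le> C * nrm A x" if "x \<in> car A" for x
        using C[of "(x, 0)"] that BB(1) n1[OF that] by (simp add: carX)
    qed
    from exA[OF this] obtain f where f: "f \<in> car A'" "\<forall>x\<in>car A. p f x = \<phi> (x, 0)"
      and fu: "\<And>f'. f' \<in> car A' \<Longrightarrow> \<forall>x\<in>car A. p f' x = \<phi> (x, 0) \<Longrightarrow> f' = f"
      by blast
    have "bdd_linear B scalars (\<lambda>y. \<phi> (0, y))"
    proof (rule functionalI)
      show "\<phi> (0, x + y) = \<phi> (0, x) + \<phi> (0, y)" if "x \<in> car B" "y \<in> car B" for x y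
        using add[OF AA(1) that(1) AA(1) that(2)] by simp
      show "\<phi> (0, scl B c x) = c * \<phi> (0, x)" if "x \<in> car B" for c x
        using hom[OF AA(1) that, of c] AA(10) by simp
      show "norm (\<phi> (0, x)) \<le> C * nrm B x" if "x \<in> car B" for x
        using C[of "(0, x)"] that AA(1) n2[OF that] by (simp add: carX)
    qed
    from exB[OF this] obtain g where g: "g \<in> car B'" "\<forall>x\<in>car B. q g x = \<phi> (0, x)"
      and gu: "\<And>f'. f' \<in> car B' \<Longrightarrow> \<forall>x\<in>car B. q f' x = \<phi> (0, x) \<Longrightarrow> f' = g"
      by blast
    show ?thesis
    proof (rule ex1I[of _ "(f, g)"])
      show "(f, g) \<in> car ?Y \<and> (\<forall>z\<in>car ?X. ?p (f, g) z = \<phi> z)"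
        using f g add[OF _ BB(1) AA(1)] by (auto simp: nspace_prod_def)
    next
      fix h assume h: "h \<in> car ?Y \<and> (\<forall>z\<in>car ?X. ?p h z = \<phi> z)"
      obtain f' g' where h': "h = (f', g')" "f' \<in> car A'" "g' \<in> car B'"
        using h by (auto simp: nspace_prod_def)
      have e: "p f' x + q g' y = \<phi> (x, y)" if "x \<in> car A" "y \<in> car B" for x y
        using h that by (auto simp: h'(1) nspace_prod_def)
      have "f' = f" using e[OF _ BB(1)] functional_0[OF assms(2) blB[OF h'(3)]] by (intro fu h') auto
      moreover have "g' = g"
        using e[OF AA(1)] functional_0[OF assms(1) blA[OF h'(2)]] by (intro gu h') auto
      ultimately show "h = (f, g)" using h' by simp
    qed
  qed
  moreover have "nrm ?Y h = (SUP z\<in>{z \<in> car ?X. nrm ?X z \<le> 1}. norm (?p h z))"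
    if hY: "h \<in> car ?Y" for h
  proof (rule antisym)
    obtain f g where h: "h = (f, g)" "f \<in> car A'" "g \<in> car B'"
      using hY by (auto simp: nspace_prod_def)
    have "nrm ?Y h \<ge> 0" using nnA[OF h(2)] nnB[OF h(3)] by (auto simp: nspace_prod_def h)
    then have "norm (?p h z) \<le> nrm ?Y h" if "z \<in> car ?X" "nrm ?X z \<le> 1" for z
      using pair_le[OF h(2,3)] that mult_left_mono[of "nrm ?X z" 1 "nrm ?Y h"]
      by (fastforce simp: carX  h)
    then show "(SUP z\<in>{z \<in> car ?X. nrm ?X z \<le> 1}. norm (?p h z)) \<le> nrm ?Y h"
      by (rule opnorm_least[OF X])
    let ?S = "SUP z\<in>{z \<in> car ?X. nrm ?X z \<le> 1}. norm (?p h z)"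
    have up: "norm (p f x + q g y) \<le> ?S"
      if "x \<in> car A" "y \<in> car B" "nrm ?X (x, y) \<le> 1" for x y
    proof -
      have "norm (?p h (x, y)) \<le> ?S"
        using that by (intro cSUP_upper opnorm_bdd[OF X bl[OF hY]]) (auto simp: carX)
      then show ?thesis by (simp add:  h)
    qed
    have z: "p f 0 = 0" "q g 0 = 0"
      using functional_0 assms(1,2) blA[OF h(2)] blB[OF h(3)] by auto
    show "nrm ?Y h \<le> ?S"
    proof (cases "e")
      case True
      have "nrm A' f \<le> ?S"
        unfolding nmA[OF h(2)]
      proof (rule opnorm_least[OF assms(1)])
        show "norm (p f x) \<le> ?S" if "x \<in> car A" "nrm A x \<le> 1" for x
          using up[of x 0] that z BB(1,5) True by (simp add: nspace_prod_def)
      qed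
      moreover have "nrm B' g \<le> ?S"
        unfolding nmB[OF h(3)]
      proof (rule opnorm_least[OF assms(2)])
        show "norm (q g x) \<le> ?S" if "x \<in> car B" "nrm B x \<le> 1" for x
          using up[of 0 x] that z AA(1,5) True by (simp add: nspace_prod_def)
      qed
      ultimately show ?thesis using True by (simp add: nspace_prod_def h)
    next
      case False
      have sum: "norm (p f x) + norm (q g y) \<le> ?S"
        if xy: "x \<in> car A" "y \<in> car B" "nrm A x \<le> 1" "nrm B y \<le> 1" for x y
      proof -
        obtain c where c: "norm c = 1" "c * p f x = of_real (norm (p f x))"
          using ex_unit_scalar by blast
        obtain d where d: "norm d = 1" "d * q g y = of_real (norm (q g y))"
          using ex_unit_scalar by blast
        have "norm (p f (scl A c x) + q g (scl B d y)) \<le> ?S"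
          using xy AA(3,8) BB(3,8) c d False by (intro up) (auto simp: nspace_prod_def)
        moreover have "p f (scl A c x) + q g (scl B d y) =
            of_real (norm (p f x) + norm (q g y))"
          using linA(2)[OF h(2) xy(1)] linB(2)[OF h(3) xy(2)] c d by simp
        moreover have "norm (of_real (norm (p f x) + norm (q g y)) :: 'a) =
            norm (p f x) + norm (q g y)"
          unfolding norm_of_real by simp
        ultimately show ?thesis by simp
      qed
      have "nrm B' g \<le> ?S - nrm A' f"
        unfolding nmB[OF h(3)]
      proof (rule opnorm_least[OF assms(2)])
        fix y assume y: "y \<in> car B" "nrm B y \<le> 1"
        have "nrm A' f \<le> ?S - norm (q g y)"
          unfolding nmA[OF h(2)]
        proof (rule opnorm_least[OF assms(1)])
          show "norm (p f x) \<le> ?S - norm (q g y)"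
            if "x \<in> car A" "nrm A x \<le> 1" for x
            using sum[of x y] that y by simp
        qed
        then show "norm (q g y) \<le> ?S - nrm A' f" by simp
      qed
      then show ?thesis using False by (simp add: nspace_prod_def h)
    qed
  qed
  moreover have "vector_space (scl ?Y)" "module.subspace (scl ?Y) (car ?Y)"
    by (simp_all only: vector_space_prod[OF v(1,3)] subspace_prod[OF v(1,3,2,4)])
  moreover have "?p (h + h') z = ?p h z + ?p h' z"
    if "h \<in> car ?Y" "h' \<in> car ?Y" "z \<in> car ?X" for h h' z
    using that by (auto simp: nspace_prod_def adA adB)
  moreover have "?p (scl ?Y c h) z = c * ?p h z"
    if "h \<in> car ?Y" "z \<in> car ?X" for h z c
    using that by (auto simp: nspace_prod_def scA scB distrib_left)
  ultimately show ?thesis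
    unfolding is_dual_def using bl by (intro conjI ballI allI impI)
qed

theorem dual_tower_dup:
  assumes "dual_tower N A pA" "dual_tower N B pB"
  shows "dual_tower N (dup_space A B) (dup_pair pA pB)"
  unfolding dual_tower_def
proof (intro conjI allI impI)
  show "banach_space (dup_space A B 0)"
    using assms by (simp add: dual_tower_def dup_space_def banach_space_prod)
  fix k assume k: "k < N"
  then have "is_dual (nspace_prod (even k) (A k) (B k))
      (nspace_prod (\<not> even k) (A (Suc k)) (B (Suc k))) (\<lambda>(f, g) (x, y). pA k f x + pB k g y)"
    using assms dual_tower_normed_space[OF assms(1)] dual_tower_normed_space[OF assms(2)]
    by (intro is_dual_prod) (auto simp: dual_tower_def)
  then show "is_dual (dup_space A B k) (dup_space A B (Suc k)) (dup_pair pA pB k)"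
    by (simp add: dup_space_def dup_pair_def)
qed

text \<open>
  Towers extend by one level, on a larger type, without changing \<open>X 0\<close>. Starting from the tower of
  length \<open>0\<close> of a Banach space this yields dual towers of every length.
\<close>

definition ext_scl :: "('k, 'u) nspace \<Rightarrow> 'k \<Rightarrow> 'u \<times> ('u \<Rightarrow> 'k::times) \<Rightarrow> 'u \<times> ('u \<Rightarrow> 'k)" where
  "ext_scl X c = (\<lambda>(x, f). (scl X c x, \<lambda>u. c * f u))"

definition ext_space :: "('k::real_normed_field, 'u) nspace \<Rightarrow> ('k, 'u \<times> ('u \<Rightarrow> 'k)) nspace" where
  "ext_space X = \<lparr>scl = ext_scl X, car = car X \<times> {0}, nrm = (\<lambda>(x, f). nrm X x)\<rparr>"

definition fun_dual ::
    "('k::real_normed_field, 'u::ab_group_add) nspace \<Rightarrow> ('k, 'u \<times> ('u \<Rightarrow> 'k)) nspace" where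
  "fun_dual X =
     \<lparr>scl = ext_scl X,
      car = {0} \<times> {f. bdd_linear X scalars f \<and> (\<forall>u. u \<notin> car X \<longrightarrow> f u = 0)},
      nrm = (\<lambda>(x, f). SUP x\<in>{x \<in> car X. nrm X x \<le> 1}. norm (f x))\<rparr>"

lemma vector_space_ext:
  assumes "vector_space (scl X)"
  shows "vector_space (ext_scl X)"
proof -
  interpret vector_space "scl X" by fact
  show ?thesis
    by unfold_locales
      (auto simp: ext_scl_def scale_right_distrib scale_left_distrib distrib_left distrib_right fun_eq_iff)
qed

lemma ext_scl_0:
  assumes "vector_space (scl X)"
  shows "ext_scl X c (x, 0) = (scl X c x, 0)" "ext_scl X c (0, f) = (0, \<lambda>u. c * f u)"
proof -
  interpret vector_space "scl X" by fact
  show "ext_scl X c (x, 0) = (scl X c x, 0)" "ext_scl X c (0, f) = (0, \<lambda>u. c * f u)"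
    by (auto simp: ext_scl_def fun_eq_iff)
qed

lemma subspace_ext:
  assumes "vector_space (scl X)" "module.subspace (scl X) (car X)"
  shows "module.subspace (scl (ext_space X)) (car (ext_space X))"
proof -
  interpret vector_space "ext_scl X" by (rule vector_space_ext[OF assms(1)])
  show ?thesis
    using subspaceD[OF assms] ext_scl_0[OF assms(1)]
    by (auto simp: ext_space_def zero_prod_def intro!: subspaceI)
qed

lemma normed_space_ext:
  assumes "normed_space X"
  shows "normed_space (ext_space X)"
proof -
  have v: "vector_space (scl X)" "module.subspace (scl X) (car X)"
    using assms by (auto simp: normed_space_def)
  note X = normed_spaceD[OF assms]
  show ?thesis
    unfolding normed_space_def
    using vector_space_ext[OF v(1)] subspace_ext[OF v] X
    by (auto simp: ext_space_def ext_scl_0[OF v(1)] zero_prod_def)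
qed

lemma banach_space_ext:
  assumes "banach_space X"
  shows "banach_space (ext_space X)"
proof -
  have c: "\<exists>x\<in>car (ext_space X). (\<lambda>i. nrm (ext_space X) (\<sigma> i - x)) \<longlonglongrightarrow> 0"
    if mem: "\<forall>i. \<sigma> i \<in> car (ext_space X)"
      and cau: "\<forall>e>0. \<exists>N. \<forall>i\<ge>N. \<forall>j\<ge>N. nrm (ext_space X) (\<sigma> i - \<sigma> j) < e"
    for \<sigma> :: "nat \<Rightarrow> 'b \<times> ('b \<Rightarrow> 'a)"
  proof -
    define f where "f i = fst (\<sigma> i)" for i
    have s: "\<sigma> i = (f i, 0)" and m: "f i \<in> car X" for i
      using mem[rule_format, of i] by (auto simp: f_def ext_space_def)
    have "\<forall>e>0. \<exists>N. \<forall>i\<ge>N. \<forall>j\<ge>N. nrm X (f i - f j) < e"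
      using cau by (simp add: s ext_space_def)
    then obtain x where "x \<in> car X" "(\<lambda>i. nrm X (f i - x)) \<longlonglongrightarrow> 0"
      using assms m unfolding banach_space_def by blast
    then show ?thesis
      by (intro bexI[of _ "(x, 0)"]) (auto simp: s ext_space_def)
  qed
  then show ?thesis
    using assms normed_space_ext unfolding banach_space_def by blast
qed

lemma bdd_linear_ext:
  assumes "vector_space (scl X)"
  shows "bdd_linear (ext_space X) scalars \<phi> \<longleftrightarrow> bdd_linear X scalars (\<lambda>x. \<phi> (x, 0))"
  by (auto simp: bdd_linear_def ext_space_def scalars_def ext_scl_0[OF assms])

lemma SUP_ext:
  "(SUP z\<in>{z \<in> car (ext_space X). nrm (ext_space X) z \<le> 1}. norm (\<phi> z)) =
   (SUP x\<in>{x \<in> car X. nrm X x \<le> 1}. norm (\<phi> (x, 0)))"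
proof -
  have "{z \<in> car (ext_space X). nrm (ext_space X) z \<le> 1} =
      (\<lambda>x. (x, 0)) ` {x \<in> car X. nrm X x \<le> 1}"
    by (auto simp: ext_space_def)
  then show ?thesis by (simp add: image_image)
qed

lemma is_dual_ext:
  assumes "normed_space X" "is_dual X Y p"
  shows "is_dual (ext_space X) (ext_space Y) (\<lambda>(a, f) (b, g). p a b)"
proof -
  have vX: "vector_space (scl X)" using assms(1) by (simp add: normed_space_def)
  note Y = is_dualD[OF assms(2)]
  note d = bdd_linear_ext[OF vX] SUP_ext
  have u: "\<exists>!h. h \<in> car (ext_space Y) \<and>
      (\<forall>z\<in>car (ext_space X). (case h of (a, f) \<Rightarrow> \<lambda>(b, g). p a b) z = \<phi> z)"
    if "bdd_linear X scalars (\<lambda>x. \<phi> (x, 0))" for \<phi>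
  proof -
    from Y(6)[OF that] obtain a where a: "a \<in> car Y" "\<forall>x\<in>car X. p a x = \<phi> (x, 0)"
      and au: "\<And>a'. a' \<in> car Y \<Longrightarrow> \<forall>x\<in>car X. p a' x = \<phi> (x, 0) \<Longrightarrow> a' = a" by blast
    show ?thesis
    proof (rule ex1I[of _ "(a, 0)"])
      show "(a, 0) \<in> car (ext_space Y) \<and>
          (\<forall>z\<in>car (ext_space X). (case (a, 0) of (a, f) \<Rightarrow> \<lambda>(b, g). p a b) z = \<phi> z)"
        using a by (auto simp: ext_space_def)
    next
      fix h assume h: "h \<in> car (ext_space Y) \<and>
          (\<forall>z\<in>car (ext_space X). (case h of (a, f) \<Rightarrow> \<lambda>(b, g). p a b) z = \<phi> z)"
      then obtain a' where a': "h = (a', 0)" "a' \<in> car Y" by (auto simp: ext_space_def)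
      then have "\<forall>x\<in>car X. p a' x = \<phi> (x, 0)" using h by (simp add: ext_space_def)
      then show "h = (a, 0)" using au[OF a'(2)] a'(1) by simp
    qed
  qed
  show ?thesis
    unfolding is_dual_def d
  proof (intro conjI ballI allI impI u)
    show "vector_space (scl (ext_space Y))"
      using vector_space_ext[OF Y(1)] by (simp add: ext_space_def)
    show "module.subspace (scl (ext_space Y)) (car (ext_space Y))"
      by (rule subspace_ext[OF Y(1,2)])
  qed (auto simp: ext_space_def ext_scl_0[OF Y(1)] Y(3) Y(4) Y(5) Y(7))
qed

lemma is_dual_fun_dual:
  assumes "normed_space X"
  shows "is_dual (ext_space X) (fun_dual X) (\<lambda>(a, f) (b, g). f b)"
proof -
  have vX: "vector_space (scl X)" using assms(1) by (simp add: normed_space_def)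
  note X = normed_spaceD[OF assms]
  note d = bdd_linear_ext[OF vX] SUP_ext
  have u: "\<exists>!h. h \<in> car (fun_dual X) \<and>
      (\<forall>z\<in>car (ext_space X). (case h of (a, f) \<Rightarrow> \<lambda>(b, g). f b) z = \<phi> z)"
    if "bdd_linear X scalars (\<lambda>x. \<phi> (x, 0))" for \<phi>
  proof (rule ex1I[of _ "(0, \<lambda>x. if x \<in> car X then \<phi> (x, 0) else 0)"])
    from that have "bdd_linear X scalars (\<lambda>x. if x \<in> car X then \<phi> (x, 0) else 0)"
      using X(2,3) by (auto simp: bdd_linear_def)
    then show "(0, \<lambda>x. if x \<in> car X then \<phi> (x, 0) else 0) \<in> car (fun_dual X) \<and>
      (\<forall>z\<in>car (ext_space X). (case (0, \<lambda>x. if x \<in> car X then \<phi> (x, 0) else 0) of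
         (a, f) \<Rightarrow> \<lambda>(b, g). f b) z = \<phi> z)"
      by (auto simp: fun_dual_def ext_space_def)
  qed (auto simp: fun_dual_def ext_space_def fun_eq_iff)
  interpret E: vector_space "ext_scl X" by (rule vector_space_ext[OF vX])
  have cl: "bdd_linear X scalars (f + g)" if f: "bdd_linear X scalars f" and g: "bdd_linear X scalars g"
    for f g :: "'b \<Rightarrow> 'a"
  proof -
    obtain C where C: "\<And>x. x \<in> car X \<Longrightarrow> norm (f x) \<le> C * nrm X x"
      using f unfolding bdd_linear_def scalars_def by auto metis
    obtain C' where C': "\<And>x. x \<in> car X \<Longrightarrow> norm (g x) \<le> C' * nrm X x"
      using g unfolding bdd_linear_def scalars_def by auto metis
    have "norm (f x + g x) \<le> (C + C') * nrm X x" if "x \<in> car X" for x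
      using norm_triangle_ineq[of "f x" "g x"] C[OF that] C'[OF that] by (simp add: distrib_right)
    then have "\<exists>C. \<forall>x\<in>car X. norm (f x + g x) \<le> C * nrm X x" by blast
    then show ?thesis using f g by (auto simp: bdd_linear_def scalars_def distrib_left)
  qed
  have cs: "bdd_linear X scalars (\<lambda>u. c * f u)" if f: "bdd_linear X scalars f"
    for c :: 'a and f :: "'b \<Rightarrow> 'a"
  proof -
    obtain C where C: "\<And>x. x \<in> car X \<Longrightarrow> norm (f x) \<le> C * nrm X x"
      using f unfolding bdd_linear_def scalars_def by auto metis
    have "norm (c * f x) \<le> (norm c * C) * nrm X x" if "x \<in> car X" for x
      using mult_left_mono[OF C[OF that] norm_ge_zero[of c]] by (simp add: norm_mult mult.assoc)
    then have "\<exists>C. \<forall>x\<in>car X. norm (c * f x) \<le> C * nrm X x" by blast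
    then show ?thesis using f by (auto simp: bdd_linear_def scalars_def distrib_left)
  qed
  have c0: "bdd_linear X scalars (0 :: 'b \<Rightarrow> 'a)"
    by (auto simp: bdd_linear_def scalars_def intro: exI[of _ 0])
  show ?thesis
    unfolding is_dual_def d
  proof (intro conjI ballI allI impI u)
    show "vector_space (scl (fun_dual X))"
      using E.vector_space_axioms by (simp add: fun_dual_def)
    show "module.subspace (scl (fun_dual X)) (car (fun_dual X))"
      using cl cs c0 ext_scl_0[OF vX]
      by (auto simp: fun_dual_def zero_prod_def intro!: E.subspaceI)
  qed (auto simp: fun_dual_def ext_space_def ext_scl_def)
qed

theorem dual_tower_extend:
  fixes X :: "nat \<Rightarrow> ('k::real_normed_field, 'u::ab_group_add) nspace"
  assumes "dual_tower N X p"
  shows "\<exists>(X' :: nat \<Rightarrow> ('k, 'u \<times> ('u \<Rightarrow> 'k)) nspace) p'.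
     dual_tower (Suc N) X' p' \<and> X' 0 = ext_space (X 0)"
proof (intro exI conjI)
  define X' where "X' k = (if k \<le> N then ext_space (X k) else fun_dual (X N))" for k
  define p' :: "nat \<Rightarrow> 'u \<times> ('u \<Rightarrow> 'k) \<Rightarrow> 'u \<times> ('u \<Rightarrow> 'k) \<Rightarrow> 'k"
    where "p' k = (if k < N then (\<lambda>(a, f) (b, g). p k a b) else (\<lambda>(a, f) (b, g). f b))" for k
  show "X' 0 = ext_space (X 0)" by (simp add: X'_def)
  have "is_dual (X' k) (X' (Suc k)) (p' k)" if "k < Suc N" for k
  proof (cases "k < N")
    case True
    then show ?thesis
      using assms dual_tower_normed_space[OF assms, of k] is_dual_ext[of "X k" "X (Suc k)" "p k"]
      by (simp add: X'_def p'_def dual_tower_def)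
  next
    case False
    then have "k = N" using that by simp
    then show ?thesis
      using is_dual_fun_dual[OF dual_tower_normed_space[OF assms, of N]] by (simp add: X'_def p'_def)
  qed
  then show "dual_tower (Suc N) X' p'"
    using assms banach_space_ext by (auto simp: dual_tower_def X'_def)
qed

end

theory Submission
  imports Defs
begin

text \<open>
  Identify an element of \<open>\<A>\<close> with \<open>(a, 0)\<close> and one of \<open>\<AA>\<close> with \<open>(0, \<beta>)\<close>. Both sides of the Leibniz
  rule of the duplication are biadditive, so the rule holds for all pairs if and only if it holds
  for each of the four combinations \<open>\<A>\<A>\<close>, \<open>\<A>\<AA>\<close>, \<open>\<AA>\<A>\<close>, \<open>\<AA>\<AA>\<close>, in each of the two coordinates
  of the dual. If the restrictions of \<open>D\<close> to the two summands have coordinates \<open>DA1\<close>, \<open>DA2\<close> and \<open>DB1\<close>,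
  \<open>DB2\<close>, these eight identities are exactly the derivation properties of \<open>DA1\<close>, \<open>DB1\<close> and \<open>DB2\<close> and the
  five identities for \<open>DA1 (\<beta> \<cdot> a)\<close>, \<open>DA1 (a \<cdot> \<beta>)\<close>, \<open>DA2 (\<beta> \<cdot> a)\<close>, \<open>DA2 (a \<cdot> \<beta>)\<close> and \<open>DA2 (ab)\<close>.

  This argument presupposes a formula for the actions of \<open>(a, \<beta>)\<close> on the odd dual in coordinates, and
  that is where the work lies. On the duplication itself, multiplication by \<open>(a, \<beta>)\<close> is an upper
  triangular \<open>2 \<times> 2\<close> matrix of operators: the diagonal consists of the module actions, the corner
  maps the \<open>\<AA>\<close>-coordinate into the \<open>\<A>\<close>-coordinate. Dualization transposes the matrix. Hence the
  matrix is lower triangular at the odd levels and upper triangular at the even levels, and its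
  corner entries obey the recursion that defines the mixed operations. The two lemmas
  \<open>transpose_upper_triangular\<close> and \<open>transpose_lower_triangular\<close> perform one dualization;
  \<open>dup_actions_even\<close> and \<open>dup_actions_odd\<close> are the resulting formulas at all levels. An element of a
  dual is only available through the functional that it represents, so all the bilinear operations
  have to be shown bounded along the way (\<open>bdd_bilinear_transpose_in\<close>): otherwise the functionals
  in the recursion need not be represented at all.
\<close>


section \<open>Bounded linear and bilinear maps\<close>

lemma bdd_linearD:
  assumes "bdd_linear X Y f"
  shows "\<And>x. x \<in> car X \<Longrightarrow> f x \<in> car Y"
    "\<And>x y. x \<in> car X \<Longrightarrow> y \<in> car X \<Longrightarrow> f (x + y) = f x + f y"
    "\<And>c x. x \<in> car X \<Longrightarrow> f (scl X c x) = scl Y c (f x)"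
  using assms by (auto simp: bdd_linear_def)

lemma bdd_linear_bound:
  assumes "normed_space X" "bdd_linear X Y f"
  obtains C where "0 \<le> C" "\<And>x. x \<in> car X \<Longrightarrow> nrm Y (f x) \<le> C * nrm X x"
proof -
  obtain C where C: "\<And>x. x \<in> car X \<Longrightarrow> nrm Y (f x) \<le> C * nrm X x"
    using assms(2) unfolding bdd_linear_def by blast
  have "nrm Y (f x) \<le> \<bar>C\<bar> * nrm X x" if "x \<in> car X" for x
    using C[OF that] mult_right_mono[OF abs_ge_self[of C] normed_spaceD(6)[OF assms(1) that]]
    by linarith
  then show thesis using that[of "\<bar>C\<bar>"] by simp
qed

lemma bdd_linear_comp:
  assumes "normed_space X" "normed_space Y" "bdd_linear X Y f" "bdd_linear Y Z g"
  shows "bdd_linear X Z (\<lambda>x. g (f x))"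
proof -
  obtain C where C: "0 \<le> C" "\<And>x. x \<in> car X \<Longrightarrow> nrm Y (f x) \<le> C * nrm X x"
    using bdd_linear_bound[OF assms(1,3)] by blast
  obtain C' where C': "0 \<le> C'" "\<And>y. y \<in> car Y \<Longrightarrow> nrm Z (g y) \<le> C' * nrm Y y"
    using bdd_linear_bound[OF assms(2,4)] by blast
  have "nrm Z (g (f x)) \<le> (C' * C) * nrm X x" if "x \<in> car X" for x
    using C'(2)[OF bdd_linearD(1)[OF assms(3) that]] mult_left_mono[OF C(2)[OF that] C'(1)]
    by (simp add: mult.assoc)
  then show ?thesis
    using bdd_linearD[OF assms(3)] bdd_linearD[OF assms(4)] unfolding bdd_linear_def
    by auto
qed

lemma bdd_linear_inl:
  assumes "normed_space X" "normed_space Y"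
  shows "bdd_linear X (nspace_prod e X Y) (\<lambda>x. (x, 0))"
  using normed_spaceD(1,5,10)[OF assms(2)] normed_spaceD(6)[OF assms(1)]
  by (auto simp: bdd_linear_def nspace_prod_def intro!: exI[of _ 1])

lemma bdd_linear_inr:
  assumes "normed_space X" "normed_space Y"
  shows "bdd_linear Y (nspace_prod e X Y) (\<lambda>y. (0, y))"
  using normed_spaceD(1,5,10)[OF assms(1)] normed_spaceD(6)[OF assms(2)]
  by (auto simp: bdd_linear_def nspace_prod_def intro!: exI[of _ 1])

lemma bdd_linear_fst:
  assumes "normed_space Y"
  shows "bdd_linear (nspace_prod e X Y) X fst"
  using normed_spaceD(6)[OF assms]
  by (auto simp: bdd_linear_def nspace_prod_def intro!: exI[of _ 1])

lemma bdd_linear_snd: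
  assumes "normed_space X"
  shows "bdd_linear (nspace_prod e X Y) Y snd"
  using normed_spaceD(6)[OF assms]
  by (auto simp: bdd_linear_def nspace_prod_def intro!: exI[of _ 1])

lemma bdd_bilinearD:
  assumes "bdd_bilinear X Y Z b"
  shows "\<And>x y. x \<in> car X \<Longrightarrow> y \<in> car Y \<Longrightarrow> b x y \<in> car Z"
    "\<And>x x' y. x \<in> car X \<Longrightarrow> x' \<in> car X \<Longrightarrow> y \<in> car Y \<Longrightarrow> b (x + x') y = b x y + b x' y"
    "\<And>x y y'. x \<in> car X \<Longrightarrow> y \<in> car Y \<Longrightarrow> y' \<in> car Y \<Longrightarrow> b x (y + y') = b x y + b x y'"
    "\<And>c x y. x \<in> car X \<Longrightarrow> y \<in> car Y \<Longrightarrow> b (scl X c x) y = scl Z c (b x y)"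
    "\<And>c x y. x \<in> car X \<Longrightarrow> y \<in> car Y \<Longrightarrow> b x (scl Y c y) = scl Z c (b x y)"
  using assms by (auto simp: bdd_bilinear_def)

lemma bdd_bilinear_zero:
  assumes "normed_space X" "normed_space Y" "bdd_bilinear X Y Z b"
  shows "\<And>y. y \<in> car Y \<Longrightarrow> b 0 y = 0" "\<And>x. x \<in> car X \<Longrightarrow> b x 0 = 0"
  using bdd_bilinearD(2)[OF assms(3), of 0 0] bdd_bilinearD(3)[OF assms(3), of _ 0 0]
    normed_spaceD(1)[OF assms(1)] normed_spaceD(1)[OF assms(2)] by auto

lemma bdd_bilinear_bound:
  assumes "normed_space X" "normed_space Y" "bdd_bilinear X Y Z b"
  obtains C where "0 \<le> C"
    "\<And>x y. x \<in> car X \<Longrightarrow> y \<in> car Y \<Longrightarrow> nrm Z (b x y) \<le> C * nrm X x * nrm Y y"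
proof -
  obtain C where C: "\<And>x y. x \<in> car X \<Longrightarrow> y \<in> car Y \<Longrightarrow> nrm Z (b x y) \<le> C * nrm X x * nrm Y y"
    using assms(3) unfolding bdd_bilinear_def by blast
  have "nrm Z (b x y) \<le> \<bar>C\<bar> * nrm X x * nrm Y y" if "x \<in> car X" "y \<in> car Y" for x y
  proof -
    have "C * (nrm X x * nrm Y y) \<le> \<bar>C\<bar> * (nrm X x * nrm Y y)"
      using normed_spaceD(6)[OF assms(1) that(1)] normed_spaceD(6)[OF assms(2) that(2)]
      by (intro mult_right_mono) auto
    then show ?thesis using C[OF that] by (simp add: mult.assoc)
  qed
  then show thesis using that[of "\<bar>C\<bar>"] by simp
qed

lemma bdd_bilinear_flip:
  assumes "bdd_bilinear X Y Z b"
  shows "bdd_bilinear Y X Z (\<lambda>y x. b x y)"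
proof -
  obtain C where "\<And>x y. x \<in> car X \<Longrightarrow> y \<in> car Y \<Longrightarrow> nrm Z (b x y) \<le> C * nrm X x * nrm Y y"
    using assms unfolding bdd_bilinear_def by blast
  then have "\<exists>C. \<forall>y\<in>car Y. \<forall>x\<in>car X. nrm Z (b x y) \<le> C * nrm Y y * nrm X x"
    by (intro exI[of _ C]) (simp add: mult.assoc mult.commute mult.left_commute)
  then show ?thesis
    using bdd_bilinearD[OF assms] by (simp add: bdd_bilinear_def)
qed


section \<open>Transposition of bilinear maps\<close>

lemma represent_eqI:
  assumes "is_dual X Y p" "f \<in> car Y" "\<And>x. x \<in> car X \<Longrightarrow> p f x = \<phi> x"
  shows "represent X Y p \<phi> = f"
  unfolding represent_def
proof (rule the_equality)
  show "f \<in> car Y \<and> (\<forall>x\<in>car X. p f x = \<phi> x)" using assms by blast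
  show "g = f" if "g \<in> car Y \<and> (\<forall>x\<in>car X. p g x = \<phi> x)" for g
    using is_dualD(6)[OF assms(1) is_dualD(3)[OF assms(1,2)]] assms(2,3) that by metis
qed

lemma is_dual_eqI:
  assumes "is_dual X Y p" "f \<in> car Y" "g \<in> car Y" "\<And>x. x \<in> car X \<Longrightarrow> p f x = p g x"
  shows "f = g"
  using represent_eqI[OF assms(1,2)] represent_eqI[OF assms(1,3)] assms(4) by metis

lemma represent_works:
  assumes "is_dual X Y p" "bdd_linear X scalars \<phi>"
  shows "represent X Y p \<phi> \<in> car Y" "\<And>x. x \<in> car X \<Longrightarrow> p (represent X Y p \<phi>) x = \<phi> x"
proof -
  obtain f where "f \<in> car Y" "\<And>x. x \<in> car X \<Longrightarrow> p f x = \<phi> x"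
    using is_dualD(6)[OF assms] by blast
  then show "represent X Y p \<phi> \<in> car Y" "\<And>x. x \<in> car X \<Longrightarrow> p (represent X Y p \<phi>) x = \<phi> x"
    using represent_eqI[OF assms(1)] by metis+
qed

text \<open>
  A bilinear map \<open>b\<close> is regarded as a family of operators \<open>b c\<close> from \<open>X\<close> to \<open>Y\<close>, parametrized by \<open>c\<close>, and
  each of them is replaced by its adjoint from \<open>Y'\<close> to \<open>X'\<close>. Both the dual of a module action and the
  mixed operations arise in this way, those with the parameter on the right
  after an exchange of the two arguments.
\<close>

definition transpose_in ::
    "('k, 'u) nspace \<Rightarrow> ('k, 'u) nspace \<Rightarrow> ('u \<Rightarrow> 'u \<Rightarrow> 'k) \<Rightarrow> ('v \<Rightarrow> 'v \<Rightarrow> 'k)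
      \<Rightarrow> ('c \<Rightarrow> 'u \<Rightarrow> 'v) \<Rightarrow> 'c \<Rightarrow> 'v \<Rightarrow> 'u" where
  "transpose_in X X' p q b c f = represent X X' p (\<lambda>x. q f (b c x))"

context
  fixes C :: "('k::real_normed_field, 'c::ab_group_add) nspace"
    and X X' :: "('k, 'u::ab_group_add) nspace" and Y Y' :: "('k, 'v::ab_group_add) nspace"
    and p q b
  assumes ns: "normed_space C" "normed_space X" "normed_space Y"
    and dual: "is_dual X X' p" "is_dual Y Y' q"
    and b: "bdd_bilinear C X Y b"
begin

lemma pairing_norm_le:
  assumes "f \<in> car Y'" "y \<in> car Y"
  shows "norm (q f y) \<le> nrm Y' f * nrm Y y"
  unfolding is_dualD(7)[OF dual(2) assms(1)]
  by (rule opnorm_upper[OF ns(3) is_dualD(3)[OF dual(2) assms(1)] assms(2)])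

lemma transpose_bound:
  "\<exists>K\<ge>0. \<forall>c\<in>car C. \<forall>f\<in>car Y'. \<forall>x\<in>car X. norm (q f (b c x)) \<le> K * nrm C c * nrm Y' f * nrm X x"
proof -
  obtain K where K: "0 \<le> K" "\<And>c x. c \<in> car C \<Longrightarrow> x \<in> car X \<Longrightarrow> nrm Y (b c x) \<le> K * nrm C c * nrm X x"
    using bdd_bilinear_bound[OF ns(1,2) b] by blast
  have "norm (q f (b c x)) \<le> K * nrm C c * nrm Y' f * nrm X x"
    if "c \<in> car C" "f \<in> car Y'" "x \<in> car X" for c f x
  proof -
    have "0 \<le> nrm Y' f" using normed_spaceD(6)[OF is_dual_normed_space[OF ns(3) dual(2)] that(2)] .
    then have "nrm Y' f * nrm Y (b c x) \<le> nrm Y' f * (K * nrm C c * nrm X x)"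
      using K(2)[OF that(1,3)] by (rule mult_left_mono[rotated])
    then show ?thesis
      using pairing_norm_le[OF that(2) bdd_bilinearD(1)[OF b that(1,3)]]
      by (simp add: mult.assoc mult.commute mult.left_commute)
  qed
  then show ?thesis using K(1) by blast
qed

lemma functional_transpose:
  assumes "c \<in> car C" "f \<in> car Y'"
  shows "bdd_linear X scalars (\<lambda>x. q f (b c x))"
proof -
  obtain K where K: "0 \<le> K" "\<And>c f x. c \<in> car C \<Longrightarrow> f \<in> car Y' \<Longrightarrow> x \<in> car X \<Longrightarrow>
       norm (q f (b c x)) \<le> K * nrm C c * nrm Y' f * nrm X x"
    using transpose_bound by metis
  note qf = functionalD(1,2)[OF is_dualD(3)[OF dual(2) assms(2)]]
  show ?thesis
    by (rule functionalI[OF _ _ K(2)[OF assms]]) (simp_all add: assms bdd_bilinearD(1,3,5)[OF b] qf)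
qed

lemmas transpose_in_car =
  represent_works(1)[OF dual(1) functional_transpose, folded transpose_in_def]

lemmas pair_transpose_in =
  represent_works(2)[OF dual(1) functional_transpose, folded transpose_in_def]

text \<open>
  Elements of \<open>X'\<close> are equal if they pair equally with \<open>X\<close>, so bilinearity passes from \<open>b\<close> and the
  pairings to the transpose. The norm of \<open>X'\<close> is a supremum of pairings, so a bound for \<open>b\<close> is also
  one for the transpose. Hence transposition can be iterated.
\<close>

lemma bdd_bilinear_transpose_in: "bdd_bilinear C Y' X' (transpose_in X X' p q b)"
proof -
  let ?T = "transpose_in X X' p q b"
  note X' = is_dual_normed_space[OF ns(2) dual(1)]
  note Y' = is_dual_normed_space[OF ns(3) dual(2)]
  note T = transpose_in_car pair_transpose_in and bc = bdd_bilinearD[OF b]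
  note C = normed_spaceD(2,3)[OF ns(1)] and X'D = normed_spaceD(2,3)[OF X'] and Y'D = normed_spaceD(2,3)[OF Y']
  note pq = is_dualD(4,5)[OF dual(1)] is_dualD(4,5)[OF dual(2)]
  note qf = functionalD(1,2)[OF is_dualD(3)[OF dual(2)]]
  have add1: "?T (c + d) f = ?T c f + ?T d f" if "c \<in> car C" "d \<in> car C" "f \<in> car Y'" for c d f
    by (rule is_dual_eqI[OF dual(1)]) (simp_all add: that T bc(1,2) C X'D pq qf)
  have add2: "?T c (f + g) = ?T c f + ?T c g" if "c \<in> car C" "f \<in> car Y'" "g \<in> car Y'" for c f g
    by (rule is_dual_eqI[OF dual(1)]) (simp_all add: that T bc(1) X'D Y'D pq)
  have scl1: "?T (scl C t c) f = scl X' t (?T c f)" if "c \<in> car C" "f \<in> car Y'" for t c f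
    by (rule is_dual_eqI[OF dual(1)]) (simp_all add: that T bc(1,4) C X'D pq qf)
  have scl2: "?T c (scl Y' t f) = scl X' t (?T c f)" if "c \<in> car C" "f \<in> car Y'" for t c f
    by (rule is_dual_eqI[OF dual(1)]) (simp_all add: that T bc(1) X'D Y'D pq)
  obtain K where K: "0 \<le> K" "\<And>c f x. c \<in> car C \<Longrightarrow> f \<in> car Y' \<Longrightarrow> x \<in> car X \<Longrightarrow>
       norm (q f (b c x)) \<le> K * nrm C c * nrm Y' f * nrm X x"
    using transpose_bound by metis
  have bd: "nrm X' (?T c f) \<le> K * nrm C c * nrm Y' f" if cf: "c \<in> car C" "f \<in> car Y'" for c f
    unfolding is_dualD(7)[OF dual(1) transpose_in_car[OF cf]]
  proof (rule opnorm_least[OF ns(2)])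
    fix x assume x: "x \<in> car X" "nrm X x \<le> 1"
    have "0 \<le> K * nrm C c * nrm Y' f"
      using K(1) normed_spaceD(6)[OF ns(1) cf(1)] normed_spaceD(6)[OF Y' cf(2)] by simp
    then have "K * nrm C c * nrm Y' f * nrm X x \<le> K * nrm C c * nrm Y' f"
      using x(2) by (rule mult_left_le[rotated])
    then show "norm (p (?T c f) x) \<le> K * nrm C c * nrm Y' f"
      using K(2)[OF cf x(1)] pair_transpose_in[OF cf x(1)] by simp
  qed
  show ?thesis
    unfolding bdd_bilinear_def using transpose_in_car add1 add2 scl1 scl2 bd by blast
qed

end


text \<open>
  One dualization of an operator matrix: the transpose of \<open>((P, Q), (0, S))\<close> is
  \<open>((P', 0), (Q', S'))\<close>. The upper left entry is a sum of two operators since both algebras act on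
  the first coordinate.
\<close>

lemma transpose_upper_triangular:
  assumes ns: "normed_space C" "normed_space E" "normed_space X" "normed_space Y"
    and dual: "is_dual X X' p" "is_dual Y Y' q"
    and bil: "bdd_bilinear C X X b1" "bdd_bilinear E X X b2" "bdd_bilinear C Y X e" "bdd_bilinear E Y Y b3"
    and T: "\<And>x y. x \<in> car X \<Longrightarrow> y \<in> car Y \<Longrightarrow> T (x, y) = (b1 c x + b2 d x + e c y, b3 d y)"
    and mem: "c \<in> car C" "d \<in> car E" "f \<in> car X'" "g \<in> car Y'"
  shows "represent (nspace_prod s X Y) (nspace_prod (\<not> s) X' Y') (\<lambda>(f, g) (x, y). p f x + q g y)
      (\<lambda>z. (\<lambda>(f, g) (x, y). p f x + q g y) (f, g) (T z)) =
    (transpose_in X X' p p b1 c f + transpose_in X X' p p b2 d f,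
     transpose_in Y Y' q p e c f + transpose_in Y Y' q q b3 d g)"
proof (rule represent_eqI[OF is_dual_prod[OF ns(3,4) dual]])
  note X' = normed_spaceD(2)[OF is_dual_normed_space[OF ns(3) dual(1)]]
    and Y' = normed_spaceD(2)[OF is_dual_normed_space[OF ns(4) dual(2)]]
  note t1 = transpose_in_car[OF ns(1,3,3) dual(1,1) bil(1) mem(1,3)]
      pair_transpose_in[OF ns(1,3,3) dual(1,1) bil(1) mem(1,3)]
    and t2 = transpose_in_car[OF ns(2,3,3) dual(1,1) bil(2) mem(2,3)]
      pair_transpose_in[OF ns(2,3,3) dual(1,1) bil(2) mem(2,3)]
    and te = transpose_in_car[OF ns(1,4,3) dual(2,1) bil(3) mem(1,3)]
      pair_transpose_in[OF ns(1,4,3) dual(2,1) bil(3) mem(1,3)]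
    and t3 = transpose_in_car[OF ns(2,4,4) dual(2,2) bil(4) mem(2,4)]
      pair_transpose_in[OF ns(2,4,4) dual(2,2) bil(4) mem(2,4)]
  show "(transpose_in X X' p p b1 c f + transpose_in X X' p p b2 d f,
      transpose_in Y Y' q p e c f + transpose_in Y Y' q q b3 d g) \<in> car (nspace_prod (\<not> s) X' Y')"
    using X'[OF t1(1) t2(1)] Y'[OF te(1) t3(1)] by (simp add: nspace_prod_def)
  fix z assume "z \<in> car (nspace_prod s X Y)"
  then obtain x y where z: "z = (x, y)" "x \<in> car X" "y \<in> car Y" by (auto simp: nspace_prod_def)
  note v = bdd_bilinearD(1)[OF bil(1) mem(1) z(2)] bdd_bilinearD(1)[OF bil(2) mem(2) z(2)]
    bdd_bilinearD(1)[OF bil(3) mem(1) z(3)]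
  note add = functionalD(1)[OF is_dualD(3)[OF dual(1) mem(3)]]
  show "(\<lambda>(f, g) (x, y). p f x + q g y)
      (transpose_in X X' p p b1 c f + transpose_in X X' p p b2 d f,
       transpose_in Y Y' q p e c f + transpose_in Y Y' q q b3 d g) z =
      (\<lambda>(f, g) (x, y). p f x + q g y) (f, g) (T z)"
    using is_dualD(4)[OF dual(1) t1(1) t2(1) z(2)] is_dualD(4)[OF dual(2) te(1) t3(1) z(3)]
      t1(2)[OF z(2)] t2(2)[OF z(2)] te(2)[OF z(3)] t3(2)[OF z(3)]
      add[OF v(1,2)] add[OF normed_spaceD(2)[OF ns(3) v(1,2)] v(3)]
    by (simp add: z(1) T[OF z(2,3)] add.assoc)
qed

text \<open>
  The same in the opposite direction, where the corner entry moves back to the first coordinate.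
\<close>

lemma transpose_lower_triangular:
  assumes ns: "normed_space C" "normed_space E" "normed_space X" "normed_space Y"
    and dual: "is_dual X X' p" "is_dual Y Y' q"
    and bil: "bdd_bilinear C X X b1" "bdd_bilinear E X X b2" "bdd_bilinear C X Y e" "bdd_bilinear E Y Y b3"
    and T: "\<And>x y. x \<in> car X \<Longrightarrow> y \<in> car Y \<Longrightarrow> T (x, y) = (b1 c x + b2 d x, e c x + b3 d y)"
    and mem: "c \<in> car C" "d \<in> car E" "f \<in> car X'" "g \<in> car Y'"
  shows "represent (nspace_prod s X Y) (nspace_prod (\<not> s) X' Y') (\<lambda>(f, g) (x, y). p f x + q g y)
      (\<lambda>z. (\<lambda>(f, g) (x, y). p f x + q g y) (f, g) (T z)) =
    (transpose_in X X' p p b1 c f + transpose_in X X' p p b2 d f + transpose_in X X' p q e c g,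
     transpose_in Y Y' q q b3 d g)"
proof (rule represent_eqI[OF is_dual_prod[OF ns(3,4) dual]])
  note X' = normed_spaceD(2)[OF is_dual_normed_space[OF ns(3) dual(1)]]
  note t1 = transpose_in_car[OF ns(1,3,3) dual(1,1) bil(1) mem(1,3)]
      pair_transpose_in[OF ns(1,3,3) dual(1,1) bil(1) mem(1,3)]
    and t2 = transpose_in_car[OF ns(2,3,3) dual(1,1) bil(2) mem(2,3)]
      pair_transpose_in[OF ns(2,3,3) dual(1,1) bil(2) mem(2,3)]
    and te = transpose_in_car[OF ns(1,3,4) dual(1,2) bil(3) mem(1,4)]
      pair_transpose_in[OF ns(1,3,4) dual(1,2) bil(3) mem(1,4)]
    and t3 = transpose_in_car[OF ns(2,4,4) dual(2,2) bil(4) mem(2,4)]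
      pair_transpose_in[OF ns(2,4,4) dual(2,2) bil(4) mem(2,4)]
  show "(transpose_in X X' p p b1 c f + transpose_in X X' p p b2 d f + transpose_in X X' p q e c g,
      transpose_in Y Y' q q b3 d g) \<in> car (nspace_prod (\<not> s) X' Y')"
    using X'[OF X'[OF t1(1) t2(1)] te(1)] t3(1) by (simp add: nspace_prod_def)
  fix z assume "z \<in> car (nspace_prod s X Y)"
  then obtain x y where z: "z = (x, y)" "x \<in> car X" "y \<in> car Y" by (auto simp: nspace_prod_def)
  note addp = functionalD(1)[OF is_dualD(3)[OF dual(1) mem(3)]]
    and addq = functionalD(1)[OF is_dualD(3)[OF dual(2) mem(4)]]
  show "(\<lambda>(f, g) (x, y). p f x + q g y)
      (transpose_in X X' p p b1 c f + transpose_in X X' p p b2 d f + transpose_in X X' p q e c g,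
       transpose_in Y Y' q q b3 d g) z =
      (\<lambda>(f, g) (x, y). p f x + q g y) (f, g) (T z)"
    using is_dualD(4)[OF dual(1) X'[OF t1(1) t2(1)] te(1) z(2)] is_dualD(4)[OF dual(1) t1(1) t2(1) z(2)]
      t1(2)[OF z(2)] t2(2)[OF z(2)] te(2)[OF z(2)] t3(2)[OF z(3)]
      addp[OF bdd_bilinearD(1)[OF bil(1) mem(1) z(2)] bdd_bilinearD(1)[OF bil(2) mem(2) z(2)]]
      addq[OF bdd_bilinearD(1)[OF bil(3) mem(1) z(2)] bdd_bilinearD(1)[OF bil(4) mem(2) z(3)]]
    by (simp add: z(1) T[OF z(2,3)] add.assoc)
qed


section \<open>The actions on iterated duals\<close>

lemma lact_0: "lact X p l r 0 = l" and ract_0: "ract X p l r 0 = r"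
  by (simp_all add: lact_def ract_def)

lemma lact_Suc: "lact X p l r (Suc k) c f =
    transpose_in (X k) (X (Suc k)) (p k) (p k) (\<lambda>c x. ract X p l r k x c) c f"
  and ract_Suc: "ract X p l r (Suc k) f c =
    transpose_in (X k) (X (Suc k)) (p k) (p k) (lact X p l r k) c f"
  by (simp_all add: lact_def ract_def transpose_in_def)

text \<open>
  The claims for the left and for the right action need a joint induction: each of the actions on a
  dual is the transpose of the opposite one a level below.
\<close>

lemma bdd_bilinear_dual_actions:
  assumes "normed_space C" "dual_tower N X p"
    and "bdd_bilinear C (X 0) (X 0) l" "bdd_bilinear (X 0) C (X 0) r" and "k \<le> N"
  shows "bdd_bilinear C (X k) (X k) (lact X p l r k)"
    and "bdd_bilinear (X k) C (X k) (ract X p l r k)"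
proof -
  have "bdd_bilinear C (X k) (X k) (lact X p l r k) \<and> bdd_bilinear (X k) C (X k) (ract X p l r k)"
    using \<open>k \<le> N\<close>
  proof (induction k)
    case 0
    then show ?case using assms by (simp add: lact_0 ract_0)
  next
    case (Suc k)
    then have d: "is_dual (X k) (X (Suc k)) (p k)" and n: "normed_space (X k)"
      using assms(2) dual_tower_normed_space[OF assms(2), of k] by (auto simp: dual_tower_def)
    note T = bdd_bilinear_transpose_in[OF assms(1) n n d d]
    have "bdd_bilinear C (X (Suc k)) (X (Suc k)) (lact X p l r (Suc k))"
      unfolding lact_Suc[abs_def] using T[OF bdd_bilinear_flip] Suc by simp
    moreover have "bdd_bilinear C (X (Suc k)) (X (Suc k)) (\<lambda>c f. ract X p l r (Suc k) f c)"
      unfolding ract_Suc using T Suc by simp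
    ultimately show ?case using bdd_bilinear_flip by fastforce
  qed
  then show "bdd_bilinear C (X k) (X k) (lact X p l r k)"
    and "bdd_bilinear (X k) C (X k) (ract X p l r k)" by auto
qed

locale duplication_tower =
  fixes A :: "nat \<Rightarrow> ('k::real_normed_field, 'u::ab_group_add) nspace"
    and pA :: "nat \<Rightarrow> 'u \<Rightarrow> 'u \<Rightarrow> 'k"
    and B :: "nat \<Rightarrow> ('k, 'v::ab_group_add) nspace"
    and pB :: "nat \<Rightarrow> 'v \<Rightarrow> 'v \<Rightarrow> 'k"
    and mA :: "'u \<Rightarrow> 'u \<Rightarrow> 'u" and mB :: "'v \<Rightarrow> 'v \<Rightarrow> 'v"
    and l :: "'v \<Rightarrow> 'u \<Rightarrow> 'u" and r :: "'u \<Rightarrow> 'v \<Rightarrow> 'u"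
    and N :: nat
  assumes towerA: "dual_tower N A pA" and towerB: "dual_tower N B pB"
    and mA: "bdd_bilinear (A 0) (A 0) (A 0) mA" and mB: "bdd_bilinear (B 0) (B 0) (B 0) mB"
    and l: "bdd_bilinear (B 0) (A 0) (A 0) l" and r: "bdd_bilinear (A 0) (B 0) (A 0) r"
begin

text \<open>
  \<open>L\<close> and \<open>R\<close> stand for the left and right action. In \<open>LBA\<close> the second letter is the acting algebra and
  the third one the space on which it acts, here \<open>\<AA>\<close> acting on the duals of \<open>\<A>\<close>. The actions of the
  duplication on its own duals are \<open>LD\<close> and \<open>RD\<close>; \<open>Leven\<close>, \<open>Reven\<close>, \<open>Lodd\<close> and \<open>Rodd\<close> are the mixed
  operations at level \<open>2m\<close> and \<open>2m + 1\<close>.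
\<close>

abbreviation "LAA \<equiv> lact A pA mA mA"
abbreviation "RAA \<equiv> ract A pA mA mA"
abbreviation "LBA \<equiv> lact A pA l r"
abbreviation "RBA \<equiv> ract A pA l r"
abbreviation "LBB \<equiv> lact B pB mB mB"
abbreviation "RBB \<equiv> ract B pB mB mB"
abbreviation "Leven m \<equiv> fst (mixed_even A pA B pB l r m)"
abbreviation "Reven m \<equiv> snd (mixed_even A pA B pB l r m)"
abbreviation "Lodd \<equiv> lmix A pA B pB l r"
abbreviation "Rodd \<equiv> rmix A pA B pB l r"
abbreviation "LD \<equiv> lact (dup_space A B) (dup_pair pA pB) (dup_mult mA mB l r) (dup_mult mA mB l r)"
abbreviation "RD \<equiv> ract (dup_space A B) (dup_pair pA pB) (dup_mult mA mB l r) (dup_mult mA mB l r)"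

lemmas nsA = dual_tower_normed_space[OF towerA] and nsB = dual_tower_normed_space[OF towerB]
lemmas nsA0 = nsA[OF le0] and nsB0 = nsB[OF le0]

lemma dualA: "k < N \<Longrightarrow> is_dual (A k) (A (Suc k)) (pA k)"
  and dualB: "k < N \<Longrightarrow> is_dual (B k) (B (Suc k)) (pB k)"
  using towerA towerB by (auto simp: dual_tower_def)

lemmas bilAA = bdd_bilinear_dual_actions[OF nsA0 towerA mA mA]
  and bilBA = bdd_bilinear_dual_actions[OF nsB0 towerA l r]
  and bilBB = bdd_bilinear_dual_actions[OF nsB0 towerB mB mB]

lemma mixed_even_0: "Leven 0 = r" "Reven 0 = l"
  by (simp_all add: fun_eq_iff)

lemma mixed_odd_eq:
  "Lodd m a x = transpose_in (B (2*m)) (B (Suc (2*m))) (pB (2*m)) (pA (2*m)) (\<lambda>a y. Reven m y a) a x"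
  "Rodd m x a = transpose_in (B (2*m)) (B (Suc (2*m))) (pB (2*m)) (pA (2*m)) (Leven m) a x"
  by (simp_all add: lmix_def rmix_def mixed_odd_def mixed_odd_step_def transpose_in_def)

lemma mixed_even_Suc:
  "Leven (Suc m) a y = transpose_in (A (Suc (2*m))) (A (Suc (Suc (2*m)))) (pA (Suc (2*m)))
     (pB (Suc (2*m))) (\<lambda>a x. Rodd m x a) a y"
  "Reven (Suc m) y a = transpose_in (A (Suc (2*m))) (A (Suc (Suc (2*m)))) (pA (Suc (2*m)))
     (pB (Suc (2*m))) (Lodd m) a y"
  by (simp_all add: lmix_def rmix_def mixed_odd_def transpose_in_def Let_def)

lemma bilinear_odd_step:
  assumes "Suc (2*m) \<le> N"
    and "bdd_bilinear (A 0) (B (2*m)) (A (2*m)) (Leven m)"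
    and "bdd_bilinear (B (2*m)) (A 0) (A (2*m)) (Reven m)"
  shows "bdd_bilinear (A 0) (A (Suc (2*m))) (B (Suc (2*m))) (Lodd m)"
    and "bdd_bilinear (A (Suc (2*m))) (A 0) (B (Suc (2*m))) (Rodd m)"
proof -
  have k: "2*m \<le> N" "2*m < N" using assms(1) by auto
  note T = bdd_bilinear_transpose_in[OF nsA0 nsB[OF k(1)] nsA[OF k(1)] dualB[OF k(2)] dualA[OF k(2)]]
  show "bdd_bilinear (A 0) (A (Suc (2*m))) (B (Suc (2*m))) (Lodd m)"
    unfolding mixed_odd_eq[abs_def] by (rule T[OF bdd_bilinear_flip[OF assms(3)]])
  have "bdd_bilinear (A 0) (A (Suc (2*m))) (B (Suc (2*m))) (\<lambda>a x. Rodd m x a)"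
    unfolding mixed_odd_eq by (rule T[OF assms(2)])
  then show "bdd_bilinear (A (Suc (2*m))) (A 0) (B (Suc (2*m))) (Rodd m)"
    by (rule bdd_bilinear_flip)
qed

lemma bilinear_even:
  assumes "2*m \<le> N"
  shows "bdd_bilinear (A 0) (B (2*m)) (A (2*m)) (Leven m)"
    and "bdd_bilinear (B (2*m)) (A 0) (A (2*m)) (Reven m)"
proof -
  have "bdd_bilinear (A 0) (B (2*m)) (A (2*m)) (Leven m) \<and>
      bdd_bilinear (B (2*m)) (A 0) (A (2*m)) (Reven m)"
    using assms
  proof (induction m)
    case 0
    then show ?case using l r unfolding mixed_even_0 by simp
  next
    case (Suc m)
    then have k: "Suc (2*m) \<le> N" "Suc (2*m) < N" by auto
    note T = bdd_bilinear_transpose_in[OF nsA0 nsA[OF k(1)] nsB[OF k(1)] dualA[OF k(2)] dualB[OF k(2)]]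
    have odd: "bdd_bilinear (A 0) (A (Suc (2*m))) (B (Suc (2*m))) (Lodd m)"
      "bdd_bilinear (A (Suc (2*m))) (A 0) (B (Suc (2*m))) (Rodd m)"
      using bilinear_odd_step[OF k(1)] Suc by auto
    have "bdd_bilinear (A 0) (B (2 * Suc m)) (A (2 * Suc m)) (Leven (Suc m))"
      unfolding mixed_even_Suc[abs_def] using T[OF bdd_bilinear_flip[OF odd(2)]] by simp
    moreover have "bdd_bilinear (A 0) (B (2 * Suc m)) (A (2 * Suc m)) (\<lambda>a y. Reven (Suc m) y a)"
      unfolding mixed_even_Suc using T[OF odd(1)] by simp
    ultimately show ?case using bdd_bilinear_flip by fastforce
  qed
  then show "bdd_bilinear (A 0) (B (2*m)) (A (2*m)) (Leven m)"
    and "bdd_bilinear (B (2*m)) (A 0) (A (2*m)) (Reven m)" by auto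
qed

lemma bilinear_odd:
  assumes "Suc (2*m) \<le> N"
  shows "bdd_bilinear (A 0) (A (Suc (2*m))) (B (Suc (2*m))) (Lodd m)"
    and "bdd_bilinear (A (Suc (2*m))) (A 0) (B (Suc (2*m))) (Rodd m)"
  using bilinear_odd_step[OF assms bilinear_even] assms by auto


section \<open>The dual actions of the duplication in coordinates\<close>

lemma car_dup: "car (dup_space A B k) = car (A k) \<times> car (B k)"
  by (simp add: dup_space_def nspace_prod_def)

lemma dup_actions_Suc:
  "LD (Suc k) z w =
     represent (nspace_prod (even k) (A k) (B k)) (nspace_prod (\<not> even k) (A (Suc k)) (B (Suc k)))
       (\<lambda>(f, g) (x, y). pA k f x + pB k g y) (\<lambda>x. (\<lambda>(f, g) (x, y). pA k f x + pB k g y) w (RD k x z))"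
  "RD (Suc k) w z =
     represent (nspace_prod (even k) (A k) (B k)) (nspace_prod (\<not> even k) (A (Suc k)) (B (Suc k)))
       (\<lambda>(f, g) (x, y). pA k f x + pB k g y) (\<lambda>x. (\<lambda>(f, g) (x, y). pA k f x + pB k g y) w (LD k z x))"
  by (simp_all add: lact_Suc[of "dup_space A B"] ract_Suc[of "dup_space A B"] transpose_in_def
      dup_space_def dup_pair_def)

text \<open>
  The induction over the levels alternates between two shapes of the same formula: the mixed term
  lies in the first coordinate at the even levels and in the second one at the odd levels.
\<close>

definition coordinate_formula_even :: "nat \<Rightarrow> bool" where
  "coordinate_formula_even m \<longleftrightarrow> (\<forall>a\<in>car (A 0). \<forall>\<beta>\<in>car (B 0). \<forall>x\<in>car (A (2*m)). \<forall>y\<in>car (B (2*m)).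
     LD (2*m) (a, \<beta>) (x, y) = (LAA (2*m) a x + LBA (2*m) \<beta> x + Leven m a y, LBB (2*m) \<beta> y) \<and>
     RD (2*m) (x, y) (a, \<beta>) = (RAA (2*m) x a + RBA (2*m) x \<beta> + Reven m y a, RBB (2*m) y \<beta>))"

definition coordinate_formula_odd :: "nat \<Rightarrow> bool" where
  "coordinate_formula_odd m \<longleftrightarrow> (\<forall>a\<in>car (A 0). \<forall>\<beta>\<in>car (B 0). \<forall>f\<in>car (A (Suc (2*m))). \<forall>g\<in>car (B (Suc (2*m))).
     LD (Suc (2*m)) (a, \<beta>) (f, g) =
       (LAA (Suc (2*m)) a f + LBA (Suc (2*m)) \<beta> f, Lodd m a f + LBB (Suc (2*m)) \<beta> g) \<and>
     RD (Suc (2*m)) (f, g) (a, \<beta>) =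
       (RAA (Suc (2*m)) f a + RBA (Suc (2*m)) f \<beta>, Rodd m f a + RBB (Suc (2*m)) g \<beta>))"

text \<open>
  The left action at the odd level is the transpose of the right action at the even level and vice
  versa, which is why the left case feeds the right operations into
  \<open>transpose_upper_triangular\<close>.
\<close>

lemma coordinate_formula_odd_step:
  assumes N: "Suc (2*m) \<le> N" and even: "coordinate_formula_even m"
  shows "coordinate_formula_odd m"
proof -
  have k: "2*m \<le> N" "2*m < N" using N by auto
  note spaces = nsA0 nsB0 nsA[OF k(1)] nsB[OF k(1)] dualA[OF k(2)] dualB[OF k(2)]
  note L = transpose_upper_triangular[OF spaces bdd_bilinear_flip[OF bilAA(2)[OF k(1)]]
      bdd_bilinear_flip[OF bilBA(2)[OF k(1)]] bdd_bilinear_flip[OF bilinear_even(2)[OF k(1)]]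
      bdd_bilinear_flip[OF bilBB(2)[OF k(1)]]]
  note R = transpose_upper_triangular[OF spaces bilAA(1)[OF k(1)] bilBA(1)[OF k(1)]
      bilinear_even(1)[OF k(1)] bilBB(1)[OF k(1)]]
  show ?thesis
    unfolding coordinate_formula_odd_def dup_actions_Suc lact_Suc[of A] lact_Suc[of B] ract_Suc[of A] ract_Suc[of B]
      mixed_odd_eq
    using even[unfolded coordinate_formula_even_def] by (intro ballI conjI L R) blast+
qed

lemma coordinate_formula_even_step:
  assumes N: "2 * Suc m \<le> N" and odd: "coordinate_formula_odd m"
  shows "coordinate_formula_even (Suc m)"
proof -
  have k: "Suc (2*m) \<le> N" "Suc (2*m) < N" using N by auto
  have e: "2 * Suc m = Suc (Suc (2*m))" by simp
  note spaces = nsA0 nsB0 nsA[OF k(1)] nsB[OF k(1)] dualA[OF k(2)] dualB[OF k(2)]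
  note L = transpose_lower_triangular[OF spaces bdd_bilinear_flip[OF bilAA(2)[OF k(1)]]
      bdd_bilinear_flip[OF bilBA(2)[OF k(1)]] bdd_bilinear_flip[OF bilinear_odd(2)[OF k(1)]]
      bdd_bilinear_flip[OF bilBB(2)[OF k(1)]]]
  note R = transpose_lower_triangular[OF spaces bilAA(1)[OF k(1)] bilBA(1)[OF k(1)]
      bilinear_odd(1)[OF k(1)] bilBB(1)[OF k(1)]]
  show ?thesis
    unfolding coordinate_formula_even_def e dup_actions_Suc(1)[of "Suc _"] dup_actions_Suc(2)[of "Suc _"]
      lact_Suc[of A _ _ _ "Suc _"] lact_Suc[of B _ _ _ "Suc _"]
      ract_Suc[of A _ _ _ "Suc _"] ract_Suc[of B _ _ _ "Suc _"] mixed_even_Suc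
    using odd[unfolded coordinate_formula_odd_def] by (intro ballI conjI L R) blast+
qed

lemma coordinate_formula_even_0: "coordinate_formula_even 0"
  by (simp add: coordinate_formula_even_def lact_0 ract_0 add_ac del: mixed_even.simps add: mixed_even_0)

lemma dup_actions_even:
  assumes "2*m \<le> N"
  shows "coordinate_formula_even m"
  using assms
proof (induction m)
  case (Suc m)
  then show ?case using coordinate_formula_even_step coordinate_formula_odd_step by simp
qed (rule coordinate_formula_even_0)

lemma dup_actions_odd:
  assumes "Suc (2*m) \<le> N"
  shows "coordinate_formula_odd m"
  using coordinate_formula_odd_step[OF assms dup_actions_even] assms by simp


section \<open>Derivations in coordinates\<close>

text \<open>
  The right-hand sides are grouped so that each bracket belongs to one of the products \<open>ab\<close>,
  \<open>a \<cdot> \<gamma>\<close>, \<open>\<beta> \<cdot> b\<close> and \<open>\<beta>\<gamma>\<close> on the left, in this order. The two equations are thus sums of four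
  equations each, and these are the eight identities into which the Leibniz rule decomposes.
\<close>

lemma leibniz_dup_iff:
  assumes k: "k = Suc (2*m)" "k \<le> N"
    and lin: "bdd_linear (A 0) (A k) DA1" "bdd_linear (B 0) (A k) DB1"
      "bdd_linear (B 0) (B k) DB2" "bdd_linear (A 0) (B k) DA2"
    and split: "\<forall>a\<in>car (A 0). \<forall>\<beta>\<in>car (B 0). D (a, \<beta>) = (DA1 a + DB1 \<beta>, DA2 a + DB2 \<beta>)"
    and mem: "a \<in> car (A 0)" "\<beta> \<in> car (B 0)" "b \<in> car (A 0)" "\<gamma> \<in> car (B 0)"
  shows "D (dup_mult mA mB l r (a, \<beta>) (b, \<gamma>)) = RD k (D (a, \<beta>)) (b, \<gamma>) + LD k (a, \<beta>) (D (b, \<gamma>)) \<longleftrightarrow>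
    DA1 (mA a b) + DA1 (r a \<gamma>) + DA1 (l \<beta> b) + DB1 (mB \<beta> \<gamma>) =
      (RAA k (DA1 a) b + LAA k a (DA1 b)) + (LAA k a (DB1 \<gamma>) + RBA k (DA1 a) \<gamma>) +
      (RAA k (DB1 \<beta>) b + LBA k \<beta> (DA1 b)) + (RBA k (DB1 \<beta>) \<gamma> + LBA k \<beta> (DB1 \<gamma>)) \<and>
    DA2 (mA a b) + DA2 (r a \<gamma>) + DA2 (l \<beta> b) + DB2 (mB \<beta> \<gamma>) =
      (Rodd m (DA1 a) b + Lodd m a (DA1 b)) + (Lodd m a (DB1 \<gamma>) + RBB k (DA2 a) \<gamma>) +
      (Rodd m (DB1 \<beta>) b + LBB k \<beta> (DA2 b)) + (RBB k (DB2 \<beta>) \<gamma> + LBB k \<beta> (DB2 \<gamma>))"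
proof -
  note D = split[rule_format]
  note A0 = normed_spaceD(2)[OF nsA0] and Ak = normed_spaceD(2)[OF nsA[OF k(2)]]
    and Bk = normed_spaceD(2)[OF nsB[OF k(2)]]
  note ab = bdd_bilinearD(1)[OF mA mem(1,3)] and a\<gamma> = bdd_bilinearD(1)[OF r mem(1,4)]
    and \<beta>b = bdd_bilinearD(1)[OF l mem(2,3)] and \<beta>\<gamma> = bdd_bilinearD(1)[OF mB mem(2,4)]
  note m1 = bdd_linearD(1)[OF lin(1)] bdd_linearD(1)[OF lin(2)]
    and m2 = bdd_linearD(1)[OF lin(4)] bdd_linearD(1)[OF lin(3)]
  note odd = dup_actions_odd[unfolded coordinate_formula_odd_def, of m, folded k(1), rule_format, OF k(2)]
  have mod: "bdd_bilinear (A 0) (A k) (B k) (Lodd m)" "bdd_bilinear (A k) (A 0) (B k) (Rodd m)"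
    using bilinear_odd[of m] k by auto
  have prod: "D (dup_mult mA mB l r (a, \<beta>) (b, \<gamma>)) =
      (DA1 (mA a b) + DA1 (r a \<gamma>) + DA1 (l \<beta> b) + DB1 (mB \<beta> \<gamma>),
       DA2 (mA a b) + DA2 (r a \<gamma>) + DA2 (l \<beta> b) + DB2 (mB \<beta> \<gamma>))"
    using D[OF A0[OF A0[OF ab a\<gamma>] \<beta>b] \<beta>\<gamma>]
      bdd_linearD(2)[OF lin(1) A0[OF ab a\<gamma>] \<beta>b] bdd_linearD(2)[OF lin(1) ab a\<gamma>]
      bdd_linearD(2)[OF lin(4) A0[OF ab a\<gamma>] \<beta>b] bdd_linearD(2)[OF lin(4) ab a\<gamma>]
    by simp
  have right: "RD k (D (a, \<beta>)) (b, \<gamma>) =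
      (RAA k (DA1 a) b + RAA k (DB1 \<beta>) b + (RBA k (DA1 a) \<gamma> + RBA k (DB1 \<beta>) \<gamma>),
       Rodd m (DA1 a) b + Rodd m (DB1 \<beta>) b + (RBB k (DA2 a) \<gamma> + RBB k (DB2 \<beta>) \<gamma>))"
    unfolding D[OF mem(1,2)]
      conjunct2[OF odd[OF mem(3,4) Ak[OF m1(1)[OF mem(1)] m1(2)[OF mem(2)]] Bk[OF m2(1)[OF mem(1)] m2(2)[OF mem(2)]]]]
      bdd_bilinearD(2)[OF bilAA(2)[OF k(2)] m1(1)[OF mem(1)] m1(2)[OF mem(2)] mem(3)]
      bdd_bilinearD(2)[OF bilBA(2)[OF k(2)] m1(1)[OF mem(1)] m1(2)[OF mem(2)] mem(4)]
      bdd_bilinearD(2)[OF mod(2) m1(1)[OF mem(1)] m1(2)[OF mem(2)] mem(3)]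
      bdd_bilinearD(2)[OF bilBB(2)[OF k(2)] m2(1)[OF mem(1)] m2(2)[OF mem(2)] mem(4)] ..
  have left: "LD k (a, \<beta>) (D (b, \<gamma>)) =
      (LAA k a (DA1 b) + LAA k a (DB1 \<gamma>) + (LBA k \<beta> (DA1 b) + LBA k \<beta> (DB1 \<gamma>)),
       Lodd m a (DA1 b) + Lodd m a (DB1 \<gamma>) + (LBB k \<beta> (DA2 b) + LBB k \<beta> (DB2 \<gamma>)))"
    unfolding D[OF mem(3,4)]
      conjunct1[OF odd[OF mem(1,2) Ak[OF m1(1)[OF mem(3)] m1(2)[OF mem(4)]] Bk[OF m2(1)[OF mem(3)] m2(2)[OF mem(4)]]]]
      bdd_bilinearD(3)[OF bilAA(1)[OF k(2)] mem(1) m1(1)[OF mem(3)] m1(2)[OF mem(4)]]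
      bdd_bilinearD(3)[OF bilBA(1)[OF k(2)] mem(2) m1(1)[OF mem(3)] m1(2)[OF mem(4)]]
      bdd_bilinearD(3)[OF mod(1) mem(1) m1(1)[OF mem(3)] m1(2)[OF mem(4)]]
      bdd_bilinearD(3)[OF bilBB(1)[OF k(2)] mem(2) m2(1)[OF mem(3)] m2(2)[OF mem(4)]] ..
  show ?thesis
    unfolding prod right left by (simp add: algebra_simps)
qed

text \<open>
  From right to left the eight identities are added up. From left to right they are separated again:
  putting one entry of each of the two factors to zero leaves a single product and a single bracket in
  either coordinate.
\<close>

lemma derivation_dup_iff:
  assumes k: "k = Suc (2*m)" "k \<le> N" and D: "bdd_linear (dup_space A B 0) (dup_space A B k) D"
  shows "derivation (dup_space A B 0) (dup_mult mA mB l r) (dup_space A B k) (LD k) (RD k) D \<longleftrightarrow>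
     (\<exists>DA1 DB1 DB2 DA2.
        derivation (A 0) mA (A k) (LAA k) (RAA k) DA1 \<and>
        derivation (B 0) mB (A k) (LBA k) (RBA k) DB1 \<and>
        derivation (B 0) mB (B k) (LBB k) (RBB k) DB2 \<and>
        bdd_linear (A 0) (B k) DA2 \<and>
        (\<forall>a\<in>car (A 0). \<forall>b\<in>car (A 0). \<forall>\<beta>\<in>car (B 0).
           D (a, \<beta>) = (DA1 a + DB1 \<beta>, DA2 a + DB2 \<beta>) \<and>
           DA1 (l \<beta> a) = RAA k (DB1 \<beta>) a + LBA k \<beta> (DA1 a) \<and>
           DA1 (r a \<beta>) = LAA k a (DB1 \<beta>) + RBA k (DA1 a) \<beta> \<and>
           DA2 (l \<beta> a) = Rodd m (DB1 \<beta>) a + LBB k \<beta> (DA2 a) \<and>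
           DA2 (r a \<beta>) = Lodd m a (DB1 \<beta>) + RBB k (DA2 a) \<beta> \<and>
           DA2 (mA a b) = Rodd m (DA1 a) b + Lodd m a (DA1 b)))"
    (is "?der \<longleftrightarrow> (\<exists>DA1 DB1 DB2 DA2. ?P DA1 DB1 DB2 DA2)")
proof
  assume "\<exists>DA1 DB1 DB2 DA2. ?P DA1 DB1 DB2 DA2"
  then obtain DA1 DB1 DB2 DA2 where P: "?P DA1 DB1 DB2 DA2" by blast
  then have lin: "bdd_linear (A 0) (A k) DA1" "bdd_linear (B 0) (A k) DB1"
      "bdd_linear (B 0) (B k) DB2" "bdd_linear (A 0) (B k) DA2"
    by (auto simp: derivation_def)
  have split: "\<forall>a\<in>car (A 0). \<forall>\<beta>\<in>car (B 0). D (a, \<beta>) = (DA1 a + DB1 \<beta>, DA2 a + DB2 \<beta>)"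
    using P by blast
  have "D (dup_mult mA mB l r (a, \<beta>) (b, \<gamma>)) = RD k (D (a, \<beta>)) (b, \<gamma>) + LD k (a, \<beta>) (D (b, \<gamma>))"
    if "a \<in> car (A 0)" "\<beta> \<in> car (B 0)" "b \<in> car (A 0)" "\<gamma> \<in> car (B 0)" for a \<beta> b \<gamma>
    unfolding leibniz_dup_iff[OF k lin split that] using P that by (simp add: derivation_def)
  then show ?der
    using D by (auto simp: derivation_def car_dup)
next
  assume der: ?der
  define DA1 DB1 DB2 DA2 where "DA1 a = fst (D (a, 0))" and "DB1 \<beta> = fst (D (0, \<beta>))"
    and "DB2 \<beta> = snd (D (0, \<beta>))" and "DA2 a = snd (D (a, 0))" for a \<beta>
  have ns: "normed_space (dup_space A B 0)" "normed_space (dup_space A B k)"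
    unfolding dup_space_def by (intro normed_space_prod nsA nsB le0 k(2))+
  have inj: "bdd_linear (A 0) (dup_space A B 0) (\<lambda>a. (a, 0))" "bdd_linear (B 0) (dup_space A B 0) (\<lambda>\<beta>. (0, \<beta>))"
    unfolding dup_space_def by (intro bdd_linear_inl bdd_linear_inr nsA0 nsB0)+
  have proj: "bdd_linear (dup_space A B k) (A k) fst" "bdd_linear (dup_space A B k) (B k) snd"
    unfolding dup_space_def by (intro bdd_linear_fst bdd_linear_snd nsA nsB k(2))+
  note DA = bdd_linear_comp[OF nsA0 ns(1) inj(1) D] and DB = bdd_linear_comp[OF nsB0 ns(1) inj(2) D]
  have lin: "bdd_linear (A 0) (A k) DA1" "bdd_linear (B 0) (A k) DB1"
      "bdd_linear (B 0) (B k) DB2" "bdd_linear (A 0) (B k) DA2"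
    unfolding DA1_def[abs_def] DB1_def[abs_def] DB2_def[abs_def] DA2_def[abs_def]
    using bdd_linear_comp[OF nsA0 ns(2) DA] bdd_linear_comp[OF nsB0 ns(2) DB] proj by auto
  note zero = normed_spaceD(1)[OF nsA0] normed_spaceD(1)[OF nsB0]
  have split: "\<forall>a\<in>car (A 0). \<forall>\<beta>\<in>car (B 0). D (a, \<beta>) = (DA1 a + DB1 \<beta>, DA2 a + DB2 \<beta>)"
  proof (intro ballI)
    fix a \<beta> assume "a \<in> car (A 0)" "\<beta> \<in> car (B 0)"
    then show "D (a, \<beta>) = (DA1 a + DB1 \<beta>, DA2 a + DB2 \<beta>)"
      using bdd_linearD(2)[OF D, of "(a, 0)" "(0, \<beta>)"] zero
      by (simp add: car_dup DA1_def DB1_def DA2_def DB2_def plus_prod_def)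
  qed
  have leib: "D (dup_mult mA mB l r (a, \<beta>) (b, \<gamma>)) = RD k (D (a, \<beta>)) (b, \<gamma>) + LD k (a, \<beta>) (D (b, \<gamma>))"
    if "a \<in> car (A 0)" "\<beta> \<in> car (B 0)" "b \<in> car (A 0)" "\<gamma> \<in> car (B 0)" for a \<beta> b \<gamma>
    using der that by (simp add: derivation_def car_dup)
  have key: "DA1 (mA a b) + DA1 (r a \<gamma>) + DA1 (l \<beta> b) + DB1 (mB \<beta> \<gamma>) =
      (RAA k (DA1 a) b + LAA k a (DA1 b)) + (LAA k a (DB1 \<gamma>) + RBA k (DA1 a) \<gamma>) +
      (RAA k (DB1 \<beta>) b + LBA k \<beta> (DA1 b)) + (RBA k (DB1 \<beta>) \<gamma> + LBA k \<beta> (DB1 \<gamma>)) \<and>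
    DA2 (mA a b) + DA2 (r a \<gamma>) + DA2 (l \<beta> b) + DB2 (mB \<beta> \<gamma>) =
      (Rodd m (DA1 a) b + Lodd m a (DA1 b)) + (Lodd m a (DB1 \<gamma>) + RBB k (DA2 a) \<gamma>) +
      (Rodd m (DB1 \<beta>) b + LBB k \<beta> (DA2 b)) + (RBB k (DB2 \<beta>) \<gamma> + LBB k \<beta> (DB2 \<gamma>))"
    if "a \<in> car (A 0)" "\<beta> \<in> car (B 0)" "b \<in> car (A 0)" "\<gamma> \<in> car (B 0)" for a \<beta> b \<gamma>
    using leib[OF that] unfolding leibniz_dup_iff[OF k lin split that] .
  have lin0: "DA1 0 = 0" "DB1 0 = 0" "DB2 0 = 0" "DA2 0 = 0"
    using bdd_linearD(2)[OF lin(1) zero(1,1)] bdd_linearD(2)[OF lin(2) zero(2,2)]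
      bdd_linearD(2)[OF lin(3) zero(2,2)] bdd_linearD(2)[OF lin(4) zero(1,1)] by auto
  have mod: "bdd_bilinear (A 0) (A k) (B k) (Lodd m)" "bdd_bilinear (A k) (A 0) (B k) (Rodd m)"
    using bilinear_odd[of m] k by auto
  note nk = nsA[OF k(2)] nsB[OF k(2)]
  \<comment> \<open>All terms but one product and its bracket vanish when two of the four entries are zero.\<close>
  note vanish = lin0 bdd_linearD(1)[OF lin(1)] bdd_linearD(1)[OF lin(2)]
    bdd_linearD(1)[OF lin(3)] bdd_linearD(1)[OF lin(4)] zero
    normed_spaceD(1)[OF nk(1)] normed_spaceD(1)[OF nk(2)]
    bdd_bilinear_zero[OF nsA0 nsA0 mA] bdd_bilinear_zero[OF nsB0 nsB0 mB]
    bdd_bilinear_zero[OF nsB0 nsA0 l] bdd_bilinear_zero[OF nsA0 nsB0 r]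
    bdd_bilinear_zero[OF nsA0 nk(1) bilAA(1)[OF k(2)]] bdd_bilinear_zero[OF nk(1) nsA0 bilAA(2)[OF k(2)]]
    bdd_bilinear_zero[OF nsB0 nk(1) bilBA(1)[OF k(2)]] bdd_bilinear_zero[OF nk(1) nsB0 bilBA(2)[OF k(2)]]
    bdd_bilinear_zero[OF nsB0 nk(2) bilBB(1)[OF k(2)]] bdd_bilinear_zero[OF nk(2) nsB0 bilBB(2)[OF k(2)]]
    bdd_bilinear_zero[OF nsA0 nk(1) mod(1)] bdd_bilinear_zero[OF nk(1) nsA0 mod(2)]
  have aa: "DA1 (mA a b) = RAA k (DA1 a) b + LAA k a (DA1 b)"
      "DA2 (mA a b) = Rodd m (DA1 a) b + Lodd m a (DA1 b)"
    if "a \<in> car (A 0)" "b \<in> car (A 0)" for a b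
    using key[OF that(1) zero(2) that(2) zero(2)] that by (simp_all add: vanish)
  have bb: "DB1 (mB \<beta> \<gamma>) = RBA k (DB1 \<beta>) \<gamma> + LBA k \<beta> (DB1 \<gamma>)"
      "DB2 (mB \<beta> \<gamma>) = RBB k (DB2 \<beta>) \<gamma> + LBB k \<beta> (DB2 \<gamma>)"
    if "\<beta> \<in> car (B 0)" "\<gamma> \<in> car (B 0)" for \<beta> \<gamma>
    using key[OF zero(1) that(1) zero(1) that(2)] that by (simp_all add: vanish)
  have ba: "DA1 (l \<beta> a) = RAA k (DB1 \<beta>) a + LBA k \<beta> (DA1 a)"
      "DA2 (l \<beta> a) = Rodd m (DB1 \<beta>) a + LBB k \<beta> (DA2 a)"
    if "\<beta> \<in> car (B 0)" "a \<in> car (A 0)" for \<beta> a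
    using key[OF zero(1) that(1,2) zero(2)] that by (simp_all add: vanish)
  have ab: "DA1 (r a \<beta>) = LAA k a (DB1 \<beta>) + RBA k (DA1 a) \<beta>"
      "DA2 (r a \<beta>) = Lodd m a (DB1 \<beta>) + RBB k (DA2 a) \<beta>"
    if "a \<in> car (A 0)" "\<beta> \<in> car (B 0)" for a \<beta>
    using key[OF that(1) zero(2,1) that(2)] that by (simp_all add: vanish)
  have "?P DA1 DB1 DB2 DA2"
    unfolding derivation_def using lin split aa bb ba ab by blast
  then show "\<exists>DA1 DB1 DB2 DA2. ?P DA1 DB1 DB2 DA2" by blast
qed

end


theorem proposition4p1:
  fixes A :: "nat \<Rightarrow> ('k::real_normed_field, 'u::ab_group_add) nspace"
    and pA :: "nat \<Rightarrow> 'u \<Rightarrow> 'u \<Rightarrow> 'k"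
    and B :: "nat \<Rightarrow> ('k, 'v::ab_group_add) nspace"
    and pB :: "nat \<Rightarrow> 'v \<Rightarrow> 'v \<Rightarrow> 'k"
    and mA :: "'u \<Rightarrow> 'u \<Rightarrow> 'u" and mB :: "'v \<Rightarrow> 'v \<Rightarrow> 'v"
    and l :: "'v \<Rightarrow> 'u \<Rightarrow> 'u" and r :: "'u \<Rightarrow> 'v \<Rightarrow> 'u"
    and n :: nat
    and D :: "'u \<times> 'v \<Rightarrow> 'u \<times> 'v"
  assumes "banach_algebra (A 0) mA" and "banach_algebra (B 0) mB"
    and "dual_tower (2*n+1) A pA" and "dual_tower (2*n+1) B pB"
    and "banach_bimodule (B 0) mB (A 0) l r"
    and "compatible_actions (A 0) mA (B 0) l r"
    and "bdd_linear (dup_space A B 0) (dup_space A B (2*n+1)) D"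
  shows
    "derivation (dup_space A B 0) (dup_mult mA mB l r) (dup_space A B (2*n+1))
        (lact (dup_space A B) (dup_pair pA pB) (dup_mult mA mB l r) (dup_mult mA mB l r) (2*n+1))
        (ract (dup_space A B) (dup_pair pA pB) (dup_mult mA mB l r) (dup_mult mA mB l r) (2*n+1)) D
     \<longleftrightarrow>
     (\<exists>DA1 DB1 DB2 DA2.
        derivation (A 0) mA (A (2*n+1)) (lact A pA mA mA (2*n+1)) (ract A pA mA mA (2*n+1)) DA1 \<and>
        derivation (B 0) mB (A (2*n+1)) (lact A pA l r (2*n+1)) (ract A pA l r (2*n+1)) DB1 \<and>
        derivation (B 0) mB (B (2*n+1)) (lact B pB mB mB (2*n+1)) (ract B pB mB mB (2*n+1)) DB2 \<and>
        bdd_linear (A 0) (B (2*n+1)) DA2 \<and>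
        (\<forall>a\<in>car (A 0). \<forall>b\<in>car (A 0). \<forall>\<beta>\<in>car (B 0).
           D (a, \<beta>) = (DA1 a + DB1 \<beta>, DA2 a + DB2 \<beta>) \<and>
           DA1 (l \<beta> a) = ract A pA mA mA (2*n+1) (DB1 \<beta>) a + lact A pA l r (2*n+1) \<beta> (DA1 a) \<and>
           DA1 (r a \<beta>) = lact A pA mA mA (2*n+1) a (DB1 \<beta>) + ract A pA l r (2*n+1) (DA1 a) \<beta> \<and>
           DA2 (l \<beta> a) = rmix A pA B pB l r n (DB1 \<beta>) a + lact B pB mB mB (2*n+1) \<beta> (DA2 a) \<and>
           DA2 (r a \<beta>) = lmix A pA B pB l r n a (DB1 \<beta>) + ract B pB mB mB (2*n+1) (DA2 a) \<beta> \<and>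
           DA2 (mA a b) = rmix A pA B pB l r n (DA1 a) b + lmix A pA B pB l r n a (DA1 b)))"
proof -
  interpret duplication_tower A pA B pB mA mB l r "2*n+1"
    using assms(1-5) by unfold_locales (auto simp: banach_algebra_def banach_bimodule_def)
  show ?thesis
    by (rule derivation_dup_iff[OF _ _ assms(7)]) simp_all
qed

end
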